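(* Let $(m_n)_{n=0}^\infty$ be a sequence of positive numbers such that for every $\alpha>0$ there exists $c=c(\alpha)>0$ with $c\,\alpha^n\le m_n$ for all $n\in\mathbb{Z}_+$, and let $$T(\lambda):=m_0\sum_{n=0}^\infty \frac{\lambda^n}{m_n},\qquad \lambda\ge 0\quad (0^0:=1).$$ Let $A$ be a scalar type spectral operator in a complex Banach space $(X,\|\cdot\|)$. Then $$C_{\{m_n\}}(A)=\bigcup_{t>0}D(T(t|A|)),\qquad C_{(m_n)}(A)=\bigcap_{t>0}D(T(t|A|)),$$ where the scalar type spectral operators $T(t|A|)$, $t>0$, are defined in the sense of the operational calculus of $A$. Moreover, in these equalities the function $T$ may be replaced with any nonnegative, continuous, and increasing function $F$ on $[0,\infty)$ for which there exist $\gamma_1,\gamma_2,c_1,c_2>0$ and $R\ge 0$ such that $$c_1F(\gamma_1\lambda)\le T(\lambda)\le c_2F(\gamma_2\lambda)\quad\text{for all }\lambda\ge R;$$ that is, for every such $F$, $C_{\{m_n\}}(A)=\bigcup_{t>0}D(F(t|A|))$ and $C_{(m_n)}(A)=\bigcap_{t>0}D(F(t|A|))$.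
   Context: $\mathbb{Z}_+=\{0,1,2,\dots\}$, $\mathbb{N}=\{1,2,3,\dots\}$; $D(\cdot)$ denotes the domain of an operator. Scalar type spectral operators and operational calculus. Let $X$ be a complex Banach space. A spectral measure $E$ on $X$ assigns to each Borel set $\delta\subseteq\mathbb{C}$ a bounded projection $E(\delta)$ on $X$, is strongly countably additive, and satisfies $E(\mathbb{C})=I$ and $E(\delta\cap\sigma)=E(\delta)E(\sigma)$. Such $E$ is uniformly bounded, and for a bounded Borel function $G:\mathbb{C}\to\mathbb{C}$ the integral $\int_{\mathbb{C}} G\,dE$ is the bounded operator obtained as the operator-norm limit of the integrals of simple Borel functions converging uniformly to $G$. For an arbitrary Borel measurable $G:\mathbb{C}\to\mathbb{C}$ put $G_n:=G\,\chi_{\{\lambda\,:\,|G(\lambda)|\le n\}}$, $n\in\mathbb{N}$, and define the operator $\int_{\mathbb{C}} G\,dE$ by $$\Big(\int_{\mathbb{C}} G\,dE\Big)f:=\lim_{n\to\infty}\Big(\int_{\mathbb{C}} G_n\,dE\Big)f$$ with domain the set of all $f\in X$ for which this limit exists. A (possibly unbounded, densely defined, closed) linear operator $A$ in $X$ is a scalar type spectral operator if there is a spectral measure $E_A$ with $A=\int_{\mathbb{C}}\lambda\,dE_A(\lambda)$ (equality including domains). Then $E_A$ is unique, is called the spectral measure (resolution of the identity) of $A$, and is supported on the spectrum $\sigma(A)$. For Borel measurable $G:\mathbb{C}\to\mathbb{C}$ (or $G:\sigma(A)\to\mathbb{C}$) one writes $G(A):=\int_{\mathbb{C}}G\,dE_A=\int_{\sigma(A)}G\,dE_A$.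 For a function $F$ on $[0,\infty)$ and $t>0$, $F(t|A|)$ denotes $G(A)$ with $G(\lambda)=F(t|\lambda|)$. Carleman classes. $C^\infty(A):=\bigcap_{n=0}^\infty D(A^n)$, and for a sequence $(m_n)_{n=0}^\infty$ of positive numbers $$C_{\{m_n\}}(A):=\{f\in C^\infty(A): \exists\alpha>0\ \exists c>0:\ \|A^nf\|\le c\,\alpha^n m_n,\ n\in\mathbb{Z}_+\},$$ $$C_{(m_n)}(A):=\{f\in C^\infty(A): \forall\alpha>0\ \exists c>0:\ \|A^nf\|\le c\,\alpha^n m_n,\ n\in\mathbb{Z}_+\}.$$ *)

theory Defs
  imports "HOL-Analysis.Analysis"
begin

class complex_banach = banach +
  fixes scaleC :: "complex \<Rightarrow> 'a \<Rightarrow> 'a"  (infixr "*\<^sub>C" 75)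
  assumes scaleC_add_right: "c *\<^sub>C (x + y) = c *\<^sub>C x + c *\<^sub>C y"
    and scaleC_add_left: "(c + d) *\<^sub>C x = c *\<^sub>C x + d *\<^sub>C x"
    and scaleC_scaleC: "c *\<^sub>C (d *\<^sub>C x) = (c * d) *\<^sub>C x"
    and scaleC_of_real: "complex_of_real r *\<^sub>C x = r *\<^sub>R x"
    and norm_scaleC: "norm (c *\<^sub>C x) = cmod c * norm x"

lemma bounded_linear_scaleC: "bounded_linear (\<lambda>x::'a::complex_banach. c *\<^sub>C x)"
proof (rule bounded_linear_intro[where K = "cmod c"])
  fix x y :: 'a and r :: real
  show "c *\<^sub>C (x + y) = c *\<^sub>C x + c *\<^sub>C y"
    by (rule scaleC_add_right)
  show "c *\<^sub>C (r *\<^sub>R x) = r *\<^sub>R (c *\<^sub>C x)"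
    by (simp add: scaleC_of_real[symmetric] scaleC_scaleC mult.commute)
  show "norm (c *\<^sub>C x) \<le> norm x * cmod c"
    by (simp add: norm_scaleC mult.commute)
qed

definition blinfun_scaleC :: "complex \<Rightarrow> 'a::complex_banach \<Rightarrow>\<^sub>L 'a" where
  "blinfun_scaleC c = Blinfun (\<lambda>x. c *\<^sub>C x)"

lemma blinfun_scaleC_apply: "blinfun_apply (blinfun_scaleC c) x = c *\<^sub>C x"
  by (simp add: blinfun_scaleC_def bounded_linear_Blinfun_apply bounded_linear_scaleC)

text \<open>Operators in a space are partial functions: the domain \<open>D(A)\<close> is \<^term>\<open>dom A\<close>, and equality
  of operators includes equality of their domains.\<close>

definition linear_operator :: "('a::complex_banach \<rightharpoonup> 'a) \<Rightarrow> bool" where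
  "linear_operator A \<longleftrightarrow>
     A 0 = Some 0 \<and>
     (\<forall>x y u v. A x = Some u \<longrightarrow> A y = Some v \<longrightarrow> A (x + y) = Some (u + v)) \<and>
     (\<forall>c x u. A x = Some u \<longrightarrow> A (c *\<^sub>C x) = Some (c *\<^sub>C u))"

definition closed_operator :: "('a::complex_banach \<rightharpoonup> 'a) \<Rightarrow> bool" where
  "closed_operator A \<longleftrightarrow> closed (Map.graph A)"

definition densely_defined :: "('a::complex_banach \<rightharpoonup> 'a) \<Rightarrow> bool" where
  "densely_defined A \<longleftrightarrow> closure (dom A) = UNIV"

primrec op_power :: "('a \<rightharpoonup> 'a) \<Rightarrow> nat \<Rightarrow> ('a \<rightharpoonup> 'a)" where
  "op_power A 0 = Some"
| "op_power A (Suc n) = A \<circ>\<^sub>m op_power A n"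

text \<open>The type \<open>'a \<Rightarrow>\<^sub>L 'a\<close> consists of the bounded real-linear maps, so complex homogeneity of the
  values is demanded separately. Only the values of \<open>E\<close> on Borel sets matter.\<close>

definition spectral_measure :: "(complex set \<Rightarrow> 'a::complex_banach \<Rightarrow>\<^sub>L 'a) \<Rightarrow> bool" where
  "spectral_measure E \<longleftrightarrow>
     (\<forall>\<delta>\<in>sets borel. \<forall>c x. blinfun_apply (E \<delta>) (c *\<^sub>C x) = c *\<^sub>C blinfun_apply (E \<delta>) x) \<and>
     (\<forall>\<delta>\<in>sets borel. E \<delta> o\<^sub>L E \<delta> = E \<delta>) \<and>
     (\<forall>\<Delta> :: nat \<Rightarrow> complex set. range \<Delta> \<subseteq> sets borel \<longrightarrow> disjoint_family \<Delta> \<longrightarrow>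
        (\<forall>f. (\<lambda>n. blinfun_apply (E (\<Delta> n)) f) sums blinfun_apply (E (\<Union>n. \<Delta> n)) f)) \<and>
     E UNIV = id_blinfun \<and>
     (\<forall>\<delta>\<in>sets borel. \<forall>\<sigma>\<in>sets borel. E (\<delta> \<inter> \<sigma>) = E \<delta> o\<^sub>L E \<sigma>)"

definition simple_spectral_integral ::
  "(complex set \<Rightarrow> 'a::complex_banach \<Rightarrow>\<^sub>L 'a) \<Rightarrow> (complex \<Rightarrow> complex) \<Rightarrow> 'a \<Rightarrow>\<^sub>L 'a" where
  "simple_spectral_integral E s = (\<Sum>y\<in>range s. blinfun_scaleC y o\<^sub>L E (s -` {y}))"

text \<open>For a bounded Borel function \<open>G\<close>, the limit in operator norm of the integrals of simple Borel
  functions converging uniformly to \<open>G\<close>; it does not depend on the approximating sequence.\<close>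

definition bounded_spectral_integral ::
  "(complex set \<Rightarrow> 'a::complex_banach \<Rightarrow>\<^sub>L 'a) \<Rightarrow> (complex \<Rightarrow> complex) \<Rightarrow> 'a \<Rightarrow>\<^sub>L 'a" where
  "bounded_spectral_integral E G =
     (THE T. \<forall>s. (\<forall>n. simple_function borel (s n)) \<longrightarrow> uniform_limit UNIV s G sequentially \<longrightarrow>
        (\<lambda>n. simple_spectral_integral E (s n)) \<longlonglongrightarrow> T)"

definition truncation :: "(complex \<Rightarrow> complex) \<Rightarrow> nat \<Rightarrow> complex \<Rightarrow> complex" where
  "truncation G n = (\<lambda>z. G z * indicator {w. cmod (G w) \<le> real n} z)"

definition spectral_integral ::
  "(complex set \<Rightarrow> 'a::complex_banach \<Rightarrow>\<^sub>L 'a) \<Rightarrow> (complex \<Rightarrow> complex) \<Rightarrow> ('a \<rightharpoonup> 'a)" where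
  "spectral_integral E G = (\<lambda>f.
     let I = (\<lambda>n. blinfun_apply (bounded_spectral_integral E (truncation G n)) f)
     in if convergent I then Some (lim I) else None)"

definition is_resolution_of_identity ::
  "('a::complex_banach \<rightharpoonup> 'a) \<Rightarrow> (complex set \<Rightarrow> 'a \<Rightarrow>\<^sub>L 'a) \<Rightarrow> bool" where
  "is_resolution_of_identity A E \<longleftrightarrow> spectral_measure E \<and> A = spectral_integral E (\<lambda>z. z)"

definition scalar_type_spectral :: "('a::complex_banach \<rightharpoonup> 'a) \<Rightarrow> bool" where
  "scalar_type_spectral A \<longleftrightarrow>
     linear_operator A \<and> densely_defined A \<and> closed_operator A \<and>
     (\<exists>E. is_resolution_of_identity A E)"

text \<open>The resolution of the identity of a scalar type spectral operator is unique on Borel sets, and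
  integrals depend only on its values there, so the choice below is immaterial.\<close>

definition resolution_of_identity ::
  "('a::complex_banach \<rightharpoonup> 'a) \<Rightarrow> complex set \<Rightarrow> 'a \<Rightarrow>\<^sub>L 'a" where
  "resolution_of_identity A = (SOME E. is_resolution_of_identity A E)"

definition op_calculus ::
  "('a::complex_banach \<rightharpoonup> 'a) \<Rightarrow> (complex \<Rightarrow> complex) \<Rightarrow> ('a \<rightharpoonup> 'a)" where
  "op_calculus A G = spectral_integral (resolution_of_identity A) G"

text \<open>\<open>F(t|A|)\<close>; only the values of \<open>F\<close> on \<open>[0,\<infinity>)\<close> are used for \<open>t > 0\<close>.\<close>

definition abs_calculus ::
  "('a::complex_banach \<rightharpoonup> 'a) \<Rightarrow> (real \<Rightarrow> real) \<Rightarrow> real \<Rightarrow> ('a \<rightharpoonup> 'a)" where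
  "abs_calculus A F t = op_calculus A (\<lambda>z. complex_of_real (F (t * cmod z)))"

definition C_infinity :: "('a::complex_banach \<rightharpoonup> 'a) \<Rightarrow> 'a set" where
  "C_infinity A = (\<Inter>n. dom (op_power A n))"

text \<open>The classes \<open>C\<^bsub>{m\<^sub>n}\<^esub>(A)\<close> (Roumieu type) and \<open>C\<^bsub>(m\<^sub>n)\<^esub>(A)\<close> (Beurling type).\<close>

definition Carleman_Roumieu ::
  "('a::complex_banach \<rightharpoonup> 'a) \<Rightarrow> (nat \<Rightarrow> real) \<Rightarrow> 'a set" where
  "Carleman_Roumieu A m =
     {f \<in> C_infinity A. \<exists>\<alpha>>0. \<exists>c>0. \<forall>n. norm (the (op_power A n f)) \<le> c * \<alpha> ^ n * m n}"

definition Carleman_Beurling ::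
  "('a::complex_banach \<rightharpoonup> 'a) \<Rightarrow> (nat \<Rightarrow> real) \<Rightarrow> 'a set" where
  "Carleman_Beurling A m =
     {f \<in> C_infinity A. \<forall>\<alpha>>0. \<exists>c>0. \<forall>n. norm (the (op_power A n f)) \<le> c * \<alpha> ^ n * m n}"

definition T_function :: "(nat \<Rightarrow> real) \<Rightarrow> real \<Rightarrow> real" where
  "T_function m x = m 0 * (\<Sum>n. x ^ n / m n)"

end

theory Submission
  imports Defs
begin

text \<open>A vector \<open>f\<close> lies in \<open>D(G(A))\<close> with value \<open>y\<close> iff \<open>E(S)y = (G\<chi>\<^sub>S)(A)f\<close> for all \<open>S\<close> in some
  exhaustion of the plane by sets on which \<open>G\<close> is bounded, so questions about unbounded functions
  reduce to the bounded calculus. If \<open>f \<in> D(T(t|A|))\<close>, then \<open>|z|\<^sup>n \<le> (m\<^sub>n / (m\<^sub>0t\<^sup>n)) T(t|z|)\<close> bounds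
  \<open>A\<^sup>nf\<close>. Conversely, if \<open>\<parallel>A\<^sup>nf\<parallel> \<le> c\<alpha>\<^sup>nm\<^sub>n\<close> and \<open>t\<alpha> < 1\<close>, then the series defining \<open>T(t|A|)f\<close>
  converges absolutely. A function \<open>F\<close> comparable with \<open>T\<close> gives the same domains up to a rescaling
  of \<open>t\<close>, because \<open>|G| \<le> C(1 + |H|)\<close> implies \<open>D(H(A)) \<subseteq> D(G(A))\<close>.\<close>

text \<open>In a general Banach space, |G| <= |H| does not by itself compare the norms of G(A)f and
  H(A)f. Every estimate therefore rests on one inequality for bounded G,
  \<open>norm (calc G)\<close> <= 4 \<open>bound\<close> sup |G|, and every comparison of functions
  writes one of them as a bounded multiple of the other plus a bounded remainder. Here
  \<open>bound\<close> is the supremum of the norms of the projections. A spectral measure is only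
  required to be strongly countably additive, so the finiteness of \<open>bound\<close> has to be
  derived. The factor 4 comes from splitting coefficients into real and imaginary parts, and each of
  these into positive and negative parts. The other obstacle is domains: \<open>op_power\<close>
  composes partial maps, whereas z^n(A) is a single integral. The balls around 0 form one exhaustion
  on which all powers and T(t|z|) are bounded, so both sides, and the series for T, can be compared
  there.\<close>

section \<open>Uniform boundedness and finite sums with bounded coefficients\<close>

text \<open>Baire category: the closed sets \<open>C n\<close> cover the space, so one of them
  contains a ball. Linearity carries the bound on that ball to the unit ball.\<close>

lemma uniform_boundedness:
  fixes T :: "'i \<Rightarrow> 'a::banach \<Rightarrow>\<^sub>L 'b::real_normed_vector"
  assumes pointwise: "\<And>x. \<exists>B. \<forall>i\<in>I. norm (T i x) \<le> B"
  obtains K where "\<And>i. i \<in> I \<Longrightarrow> norm (T i) \<le> K"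
proof -
  define C where "C n = {x. \<forall>i\<in>I. norm (T i x) \<le> real n}" for n
  have closed: "closed (C n)" for n
  proof -
    have "C n = (\<Inter>i\<in>I. {x. norm (T i x) \<le> real n})"
      by (auto simp: C_def)
    then show ?thesis
      by (auto intro!: closed_INT closed_Collect_le continuous_intros)
  qed
  have cover: "(\<Union>n. C n) = UNIV"
  proof -
    have "\<exists>n. x \<in> C n" for x
    proof -
      obtain B where B: "\<forall>i\<in>I. norm (T i x) \<le> B" using pointwise by blast
      obtain n where "B \<le> real n" using real_arch_simple by blast
      with B have "x \<in> C n" by (fastforce simp: C_def)
      then show ?thesis ..
    qed
    then show ?thesis by auto
  qed
  have "\<exists>n. interior (C n) \<noteq> {}"
  proof (rule ccontr)
    assume "\<nexists>n. interior (C n) \<noteq> {}"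
    then have "\<And>S. S \<in> range C \<Longrightarrow> closedin Met_TC.mtopology S \<and> Met_TC.mtopology interior_of S = {}"
      using closed by (auto simp: mtopology_is_euclidean)
    moreover have "Met_TC.mcomplete TYPE('a)"
      by (simp add: complete_UNIV)
    ultimately have "Met_TC.mtopology interior_of \<Union>(range C) = {}"
      by (intro Met_TC.metric_Baire_category_alt) auto
    then show False
      using cover by (simp add: mtopology_is_euclidean)
  qed
  then obtain n a where "a \<in> interior (C n)" by blast
  then obtain r where r: "r > 0" "cball a r \<subseteq> C n"
    unfolding mem_interior_cball by blast
  have "norm (T i) \<le> 2 * real n / r" if i: "i \<in> I" for i
  proof (rule norm_blinfun_bound)
    show "0 \<le> 2 * real n / r" using r by simp
    fix x
    show "norm (T i x) \<le> 2 * real n / r * norm x"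
    proof (cases "x = 0")
      case False
      \<comment> \<open>With this scaling both \<open>a\<close> and \<open>a + s *\<^sub>R x\<close>
        lie in the ball, and their difference is a multiple of \<open>x\<close>.\<close>
      define s where "s = r / norm x"
      have s: "s > 0" using r False by (simp add: s_def)
      have "a + s *\<^sub>R x \<in> C n" "a \<in> C n"
        using r s False by (auto simp: s_def dist_norm)
      then have "norm (T i (a + s *\<^sub>R x)) \<le> n" "norm (T i a) \<le> n"
        using i by (auto simp: C_def)
      then have "norm (T i (a + s *\<^sub>R x) - T i a) \<le> 2 * real n"
        using norm_triangle_ineq4[of "T i (a + s *\<^sub>R x)" "T i a"] by linarith
      then have "s * norm (T i x) \<le> 2 * real n"
        using s by (simp add: blinfun.add_right blinfun.scaleR_right)
      then show ?thesis
        using r False by (simp add: s_def field_simps)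
    qed simp
  qed
  then show ?thesis using that by blast
qed

lemma scaleC_sum_right: "c *\<^sub>C (\<Sum>i\<in>I. v i) = (\<Sum>i\<in>I. c *\<^sub>C v i)"
  by (rule linear_sum[OF bounded_linear.linear[OF bounded_linear_scaleC]])

lemma scaleC_zero_left [simp]: "0 *\<^sub>C x = 0"
  using scaleC_of_real[of 0 x] by simp

lemma scaleC_zero_right [simp]: "c *\<^sub>C 0 = 0"
  using scaleC_scaleC[of c 0] by (metis mult_zero_right scaleC_zero_left)

lemma scaleC_one [simp]: "1 *\<^sub>C x = x"
  using scaleC_of_real[of 1 x] by simp

text \<open>A point of the unit cube is a convex combination of its vertices, so coefficients in
  [0,1] do no worse than subset sums. The offset \<open>y\<close> collects the terms already decided
  and makes the induction go through.\<close>

lemma norm_sum_unit_interval_le: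
  fixes v :: "'i \<Rightarrow> 'a::real_normed_vector"
  assumes "finite I" and "\<And>i. i \<in> I \<Longrightarrow> 0 \<le> a i \<and> a i \<le> 1"
    and "\<And>J. J \<subseteq> I \<Longrightarrow> norm (y + sum v J) \<le> B"
  shows "norm (y + (\<Sum>i\<in>I. a i *\<^sub>R v i)) \<le> B"
  using assms
proof (induction I arbitrary: y rule: finite_induct)
  case empty
  then show ?case by simp
next
  case (insert k I)
  have 1: "norm (y + (\<Sum>i\<in>I. a i *\<^sub>R v i)) \<le> B"
    using insert.prems by (intro insert.IH) auto
  have 2: "norm ((y + v k) + (\<Sum>i\<in>I. a i *\<^sub>R v i)) \<le> B"
  proof (intro insert.IH)
    fix J assume J: "J \<subseteq> I"
    then have "norm (y + sum v (insert k J)) \<le> B" by (intro insert.prems) auto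
    moreover have "finite J" "k \<notin> J" using J insert.hyps finite_subset by auto
    ultimately show "norm (y + v k + sum v J) \<le> B" by (simp add: add.assoc)
  qed (use insert.prems in auto)
  have a: "0 \<le> a k" "a k \<le> 1" using insert.prems by auto
  have "y + (\<Sum>i\<in>insert k I. a i *\<^sub>R v i) =
      (1 - a k) *\<^sub>R (y + (\<Sum>i\<in>I. a i *\<^sub>R v i)) + a k *\<^sub>R ((y + v k) + (\<Sum>i\<in>I. a i *\<^sub>R v i))"
    using insert.hyps by (simp add: algebra_simps)
  also have "norm \<dots> \<le> (1 - a k) * B + a k * B"
    using 1 2 a by (intro norm_triangle_le add_mono) (auto intro!: mult_left_mono)
  finally show ?case by (simp add: algebra_simps)
qed

text \<open>Positive and negative parts, divided by \<open>c\<close>, have coefficients in [0,1];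
  each part contributes one \<open>c * B\<close>.\<close>

lemma norm_sum_scaleR_le:
  fixes v :: "'i \<Rightarrow> 'a::real_normed_vector"
  assumes fin: "finite I" and a: "\<And>i. i \<in> I \<Longrightarrow> \<bar>a i\<bar> \<le> c" and "0 \<le> c"
    and B: "\<And>J. J \<subseteq> I \<Longrightarrow> norm (sum v J) \<le> B"
  shows "norm (\<Sum>i\<in>I. a i *\<^sub>R v i) \<le> 2 * c * B"
proof (cases "c > 0")
  case True
  have *: "norm (\<Sum>i\<in>I. b i *\<^sub>R v i) \<le> B" if "\<And>i. i \<in> I \<Longrightarrow> 0 \<le> b i \<and> b i \<le> 1" for b
    using norm_sum_unit_interval_le[OF fin, of b 0 v B] that B by simp
  have "(\<Sum>i\<in>I. a i *\<^sub>R v i) =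
      c *\<^sub>R ((\<Sum>i\<in>I. (max 0 (a i) / c) *\<^sub>R v i) - (\<Sum>i\<in>I. (max 0 (- a i) / c) *\<^sub>R v i))"
    unfolding sum_subtractf[symmetric] scaleR_sum_right scaleR_left_diff_distrib[symmetric]
    using True by (intro sum.cong) (auto simp: max_def field_simps)
  also have "norm \<dots> \<le> c * (B + B)"
    unfolding norm_scaleR using True a
    by (intro mult_mono order.trans[OF norm_triangle_ineq4] add_mono *)
      (auto simp: max_def divide_le_eq abs_le_iff)
  finally show ?thesis by simp
next
  case False
  with \<open>0 \<le> c\<close> have "c = 0" by simp
  moreover from this have "a i = 0" if "i \<in> I" for i using a[OF that] by simp
  ultimately show ?thesis by simp
qed

text \<open>Meant for \<open>v i\<close> = E(S_i)x with disjoint S_i: subset sums are then again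
  values of the measure, so the bound does not depend on the number of terms.\<close>

lemma norm_sum_scaleC_le:
  fixes v :: "'i \<Rightarrow> 'a::complex_banach"
  assumes fin: "finite I" and a: "\<And>i. i \<in> I \<Longrightarrow> cmod (a i) \<le> c" and c: "0 \<le> c"
    and B: "\<And>J. J \<subseteq> I \<Longrightarrow> norm (sum v J) \<le> B"
  shows "norm (\<Sum>i\<in>I. a i *\<^sub>C v i) \<le> 4 * c * B"
proof -
  have "a i *\<^sub>C v i = Re (a i) *\<^sub>R v i + \<i> *\<^sub>C (Im (a i) *\<^sub>R v i)" for i
    unfolding scaleC_of_real[symmetric] scaleC_scaleC scaleC_add_left[symmetric]
    by (simp add: complex_eq[symmetric])
  then have "(\<Sum>i\<in>I. a i *\<^sub>C v i) =
      (\<Sum>i\<in>I. Re (a i) *\<^sub>R v i) + \<i> *\<^sub>C (\<Sum>i\<in>I. Im (a i) *\<^sub>R v i)"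
    by (simp add: sum.distrib scaleC_sum_right)
  also have "norm \<dots> \<le> 2 * c * B + 2 * c * B"
  proof (intro norm_triangle_le add_mono)
    show "norm (\<Sum>i\<in>I. Re (a i) *\<^sub>R v i) \<le> 2 * c * B"
      using a by (intro norm_sum_scaleR_le fin B c order.trans[OF abs_Re_le_cmod])
    show "norm (\<i> *\<^sub>C (\<Sum>i\<in>I. Im (a i) *\<^sub>R v i)) \<le> 2 * c * B"
      unfolding norm_scaleC norm_ii mult_1
      using a by (intro norm_sum_scaleR_le fin B c order.trans[OF abs_Im_le_cmod])
  qed
  finally show ?thesis by (simp add: algebra_simps)
qed

subsection \<open>Spectral measures\<close>

locale spectral =
  fixes E :: "complex set \<Rightarrow> 'a::complex_banach \<Rightarrow>\<^sub>L 'a"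
  assumes spectral_measure: "spectral_measure E"
begin

lemma E_scaleC: "S \<in> sets borel \<Longrightarrow> E S (c *\<^sub>C x) = c *\<^sub>C E S x"
  using spectral_measure by (simp add: spectral_measure_def)

lemma E_Int: "S \<in> sets borel \<Longrightarrow> T \<in> sets borel \<Longrightarrow> E (S \<inter> T) x = E S (E T x)"
  using spectral_measure by (simp add: spectral_measure_def)

lemma E_UNIV [simp]: "E UNIV x = x"
  using spectral_measure by (simp add: spectral_measure_def)

lemma E_sums:
  "range S \<subseteq> sets borel \<Longrightarrow> disjoint_family S \<Longrightarrow> (\<lambda>n. E (S n) x) sums E (\<Union>n. S n) x"
  using spectral_measure by (simp add: spectral_measure_def)

text \<open>Additivity over countably many empty sets gives a convergent series with constant
  terms.\<close>

lemma E_empty [simp]: "E {} x = 0"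
proof -
  have "(\<lambda>n::nat. E {} x) sums E (\<Union>n::nat. {}) x"
    by (rule E_sums) (auto simp: disjoint_family_on_def)
  then have "(\<lambda>n::nat. E {} x) \<longlonglongrightarrow> 0"
    by (rule summable_LIMSEQ_zero[OF sums_summable])
  then show ?thesis by (simp add: LIMSEQ_const_iff)
qed

lemma E_Un:
  assumes "S \<in> sets borel" "T \<in> sets borel" "S \<inter> T = {}"
  shows "E (S \<union> T) x = E S x + E T x"
proof -
  have "(\<lambda>n. E (binaryset S T n) x) sums E (\<Union>n. binaryset S T n) x"
    using assms
    by (intro E_sums) (auto simp: range_binaryset_eq disjoint_family_on_def binaryset_def)
  moreover have "(\<lambda>n. E (binaryset S T n) x) sums (E S x + E T x)"
    by (rule binaryset_sums[of "\<lambda>S. E S x"]) simp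
  ultimately show ?thesis
    unfolding UN_binaryset_eq by (rule sums_unique2)
qed

lemma E_UN:
  assumes "finite I" "\<And>i. i \<in> I \<Longrightarrow> S i \<in> sets borel" "disjoint_family_on S I"
  shows "E (\<Union>i\<in>I. S i) x = (\<Sum>i\<in>I. E (S i) x)"
  using assms
proof (induction I rule: finite_induct)
  case (insert k I)
  have "E (S k \<union> (\<Union>i\<in>I. S i)) x = E (S k) x + E (\<Union>i\<in>I. S i) x"
    using insert.hyps insert.prems
    by (intro E_Un sets.finite_UN) (auto simp: disjoint_family_on_def)
  then show ?case
    using insert by (auto simp: disjoint_family_on_def)
qed simp

lemma E_incseq:
  assumes S: "\<And>n. S n \<in> sets borel" and "incseq S"
  shows "(\<lambda>n. E (S n) x) \<longlonglongrightarrow> E (\<Union>n. S n) x"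
proof -
  have "range (disjointed S) \<subseteq> sets borel"
    using S by (intro sets.range_disjointed_sets) auto
  then have D: "disjointed S n \<in> sets borel" for n by auto
  have "(\<lambda>n. E (disjointed S n) x) sums E (\<Union>n. disjointed S n) x"
    using D by (intro E_sums disjoint_family_disjointed) auto
  then have "(\<lambda>n. \<Sum>i<Suc n. E (disjointed S i) x) \<longlonglongrightarrow> E (\<Union>n. S n) x"
    unfolding sums_def UN_disjointed_eq by (rule LIMSEQ_Suc)
  moreover have "(\<Sum>i<Suc n. E (disjointed S i) x) = E (S n) x" for n
  proof -
    have "(\<Sum>i<Suc n. E (disjointed S i) x) = E (\<Union>i<Suc n. disjointed S i) x"
      using D disjoint_family_disjointed[of S]
      by (intro E_UN[symmetric]) (auto intro: disjoint_family_on_mono)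
    also have "(\<Union>i<Suc n. disjointed S i) = (\<Union>i<Suc n. S i)"
      using finite_UN_disjointed_eq[of S "Suc n"] by (simp only: atLeast0LessThan)
    also have "\<dots> = S n"
      using \<open>incseq S\<close> by (fastforce simp: incseq_def less_Suc_eq_le)
    finally show ?thesis .
  qed
  ultimately show ?thesis by simp
qed

text \<open>Were the measure \<open>E(\<cdot>)x\<close> unbounded, halving would give a decreasing sequence of sets
  on which it remains unbounded and whose successive differences have measure of norm at least 1,
  against countable additivity.\<close>

lemma E_pointwise_bounded: "\<exists>B. \<forall>S\<in>sets borel. norm (E S x) \<le> B"
proof (rule ccontr)
  \<comment> \<open>\<open>U A\<close> says that the measure of \<open>x\<close> is unbounded on the
    Borel subsets of \<open>A\<close>.\<close>
  define U where "U A \<longleftrightarrow> A \<in> sets borel \<and> (\<forall>B. \<exists>S\<in>sets borel. S \<subseteq> A \<and> norm (E S x) > B)" for A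
  have split: "E A x = E (A \<inter> S) x + E (A - S) x" if "A \<in> sets borel" "S \<in> sets borel" for A S
    using E_Un[of "A \<inter> S" "A - S" x] that by (simp add: Int_Diff_Un Int_Diff_disjoint)
  have step: "\<exists>A'. U A' \<and> A' \<subseteq> A \<and> 1 \<le> norm (E (A - A') x)" if A: "U A" for A
  proof -
    \<comment> \<open>The excess over \<open>norm (E A x) + 1\<close> forces both \<open>S\<close>
      and \<open>A - S\<close> to have measure of norm at least 1. Hence whichever half inherits
      unboundedness, the discarded one is large.\<close>
    obtain S where S: "S \<in> sets borel" "S \<subseteq> A" "norm (E S x) > norm (E A x) + 1"
      using A unfolding U_def by meson
    have [measurable]: "A \<in> sets borel" using A by (simp add: U_def)
    have "E A x = E S x + E (A - S) x"
      using split[of A S] S by (simp add: Int_absorb1)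
    then have "norm (E S x) \<le> norm (E A x) + norm (E (A - S) x)"
      using norm_triangle_ineq4[of "E A x" "E (A - S) x"] by simp
    with S(3) norm_ge_zero[of "E A x"]
    have big: "norm (E S x) \<ge> 1" "norm (E (A - S) x) \<ge> 1" by linarith+
    have "U S \<or> U (A - S)"
    proof (rule ccontr)
      assume "\<not> ?thesis"
      moreover have "S \<in> sets borel" "A - S \<in> sets borel" using S by auto
      ultimately obtain B1 B2 where
        B1: "\<And>T. T \<in> sets borel \<Longrightarrow> T \<subseteq> S \<Longrightarrow> norm (E T x) \<le> B1" and
        B2: "\<And>T. T \<in> sets borel \<Longrightarrow> T \<subseteq> A - S \<Longrightarrow> norm (E T x) \<le> B2"
        unfolding U_def by (meson not_le)
      obtain T where T: "T \<in> sets borel" "T \<subseteq> A" "norm (E T x) > B1 + B2"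
        using A unfolding U_def by meson
      have "norm (E (T \<inter> S) x) \<le> B1" "norm (E (T - S) x) \<le> B2"
        using T S by (auto intro!: B1 B2)
      then show False
        using T S split[of T S] norm_triangle_ineq[of "E (T \<inter> S) x" "E (T - S) x"] by auto
    qed
    moreover have "A - (A - S) = S" using S by auto
    ultimately show ?thesis
      using S big by (metis Diff_subset)
  qed
  assume "\<nexists>B. \<forall>S\<in>sets borel. norm (E S x) \<le> B"
  then have "U UNIV" by (auto simp: U_def not_le)
  then have "\<exists>A. \<forall>n::nat. U (A n) \<and> (A (Suc n) \<subseteq> A n \<and> 1 \<le> norm (E (A n - A (Suc n)) x))"
    using step by (intro dependent_nat_choice[of "\<lambda>_. U" "\<lambda>_ A A'. A' \<subseteq> A \<and> 1 \<le> norm (E (A - A') x)"]) blast+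
  then obtain A where *: "\<forall>n::nat. U (A n) \<and> (A (Suc n) \<subseteq> A n \<and> 1 \<le> norm (E (A n - A (Suc n)) x))" ..
  have A: "U (A n)" "A (Suc n) \<subseteq> A n \<and> 1 \<le> norm (E (A n - A (Suc n)) x)" for n
    using spec[OF *, of n] by simp_all
  have anti: "A j \<subseteq> A i" if "i \<le> j" for i j
    using A(2)[THEN conjunct1] that by (rule lift_Suc_antimono_le)
  have "disjoint_family (\<lambda>n. A n - A (Suc n))"
    unfolding disjoint_family_on_def
  proof (intro ballI impI)
    fix i j :: nat assume "i \<noteq> j"
    then have "Suc i \<le> j \<or> Suc j \<le> i" by auto
    then show "(A i - A (Suc i)) \<inter> (A j - A (Suc j)) = {}"
      using anti by blast
  qed
  moreover have "range (\<lambda>n. A n - A (Suc n)) \<subseteq> sets borel"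
    using A(1) by (auto simp: U_def)
  ultimately have "(\<lambda>n. E (A n - A (Suc n)) x) sums E (\<Union>n. A n - A (Suc n)) x"
    by (intro E_sums)
  then have "(\<lambda>n. norm (E (A n - A (Suc n)) x)) \<longlonglongrightarrow> 0"
    by (intro tendsto_norm_zero summable_LIMSEQ_zero[OF sums_summable])
  moreover have "\<forall>\<^sub>F n in sequentially. 1 \<le> norm (E (A n - A (Suc n)) x)"
    using A(2) by (intro always_eventually) simp
  ultimately have "1 \<le> (0::real)" by (rule tendsto_lowerbound) simp
  then show False by simp
qed

definition bound :: real where
  "bound = (SUP S\<in>sets borel. norm (E S))"

text \<open>The pointwise bounds become a common operator bound, which makes the supremum in
  \<open>bound\<close> a genuine one.\<close>

lemma norm_E_le: "S \<in> sets borel \<Longrightarrow> norm (E S) \<le> bound"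
proof -
  obtain K where "\<And>S. S \<in> sets borel \<Longrightarrow> norm (E S) \<le> K"
    using uniform_boundedness[of "sets borel" E] E_pointwise_bounded by blast
  then show "S \<in> sets borel \<Longrightarrow> norm (E S) \<le> bound"
    unfolding bound_def by (intro cSUP_upper bdd_aboveI2[where M = K])
qed

lemma bound_nonneg: "0 \<le> bound"
  by (rule order.trans[OF norm_ge_zero norm_E_le[of UNIV]]) simp


subsection \<open>Integrals of simple functions\<close>

lemma simple_integral_apply:
  "simple_spectral_integral E s x = (\<Sum>y\<in>range s. y *\<^sub>C E (s -` {y}) x)"
  by (simp add: simple_spectral_integral_def blinfun.sum_left blinfun_scaleC_apply)

lemma simple_function_vimage_borel:
  fixes p :: "complex \<Rightarrow> 'b"
  assumes "simple_function borel p"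
  shows "finite (range p)" "p -` V \<in> sets borel"
proof -
  show fin: "finite (range p)" using simple_functionD(1)[OF assms] by simp
  have "p -` V = (\<Union>v\<in>V \<inter> range p. p -` {v})" by auto
  moreover have "p -` {v} \<in> sets borel" for v
    using simple_functionD(2)[OF assms, of "{v}"] by simp
  ultimately show "p -` V \<in> sets borel" using fin by (auto intro!: sets.finite_UN)
qed

lemma E_simple_vimage:
  fixes p :: "complex \<Rightarrow> 'b"
  assumes "simple_function borel p" "V \<subseteq> range p"
  shows "E (p -` V) x = (\<Sum>v\<in>V. E (p -` {v}) x)"
proof -
  have "p -` V = (\<Union>v\<in>V. p -` {v})" by auto
  moreover have "finite V"
    using simple_function_vimage_borel(1)[OF assms(1)] assms(2) finite_subset by blast
  ultimately show ?thesis
    using simple_function_vimage_borel(2)[OF assms(1)]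
    by (simp only:) (intro E_UN, auto simp: disjoint_family_on_def)
qed

text \<open>Integration along a common refinement \<open>p\<close>; taking for \<open>p\<close> the pair of two simple functions
  makes the algebraic laws of the integral evident.\<close>

lemma simple_integral_comp:
  fixes p :: "complex \<Rightarrow> 'b" and h :: "'b \<Rightarrow> complex"
  assumes p: "simple_function borel p"
  shows "simple_spectral_integral E (\<lambda>z. h (p z)) x = (\<Sum>v\<in>range p. h v *\<^sub>C E (p -` {v}) x)"
proof -
  have fin: "finite (range p)" using p by (rule simple_function_vimage_borel)
  have "(\<Sum>v\<in>range p. h v *\<^sub>C E (p -` {v}) x) =
      (\<Sum>y\<in>h ` range p. \<Sum>v | v \<in> range p \<and> h v = y. h v *\<^sub>C E (p -` {v}) x)"
    using fin by (rule sum.image_gen)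
  also have "\<dots> = (\<Sum>y\<in>range (\<lambda>z. h (p z)). y *\<^sub>C E ((\<lambda>z. h (p z)) -` {y}) x)"
  proof (intro sum.cong)
    fix y
    have "(\<Sum>v | v \<in> range p \<and> h v = y. h v *\<^sub>C E (p -` {v}) x) =
        y *\<^sub>C (\<Sum>v | v \<in> range p \<and> h v = y. E (p -` {v}) x)"
      unfolding scaleC_sum_right by (intro sum.cong) auto
    also have "(\<Sum>v | v \<in> range p \<and> h v = y. E (p -` {v}) x) =
        E (p -` {v \<in> range p. h v = y}) x"
      by (intro E_simple_vimage[symmetric] p) auto
    also have "p -` {v \<in> range p. h v = y} = (\<lambda>z. h (p z)) -` {y}" by auto
    finally show "(\<Sum>v | v \<in> range p \<and> h v = y. h v *\<^sub>C E (p -` {v}) x) =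
        y *\<^sub>C E ((\<lambda>z. h (p z)) -` {y}) x" .
  qed (simp add: image_image)
  finally show ?thesis by (simp add: simple_integral_apply)
qed

lemma simple_integral_add:
  assumes "simple_function borel s" "simple_function borel t"
  shows "simple_spectral_integral E (\<lambda>z. s z + t z) =
    simple_spectral_integral E s + simple_spectral_integral E t"
proof (rule blinfun_eqI)
  fix x
  show "simple_spectral_integral E (\<lambda>z. s z + t z) x =
      (simple_spectral_integral E s + simple_spectral_integral E t) x"
    using simple_integral_comp[OF simple_function_Pair[OF assms], of "\<lambda>v. fst v + snd v" x]
      simple_integral_comp[OF simple_function_Pair[OF assms], of fst x]
      simple_integral_comp[OF simple_function_Pair[OF assms], of snd x]
    by (simp add: scaleC_add_left sum.distrib blinfun.add_left)
qed

text \<open>The projections of distinct level sets of the pair \<open>p\<close> annihilate each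
  other, so the double sum collapses to its diagonal.\<close>

lemma simple_integral_mult:
  assumes "simple_function borel s" "simple_function borel t"
  shows "simple_spectral_integral E (\<lambda>z. s z * t z) =
    simple_spectral_integral E s o\<^sub>L simple_spectral_integral E t"
proof (rule blinfun_eqI)
  fix x
  define p where "p z = (s z, t z)" for z
  have p: "simple_function borel p"
    unfolding p_def using assms by (rule simple_function_Pair)
  note fin = simple_function_vimage_borel(1)[OF p]
  note [measurable, simp] = simple_function_vimage_borel(2)[OF p]
  have orth: "E (p -` {v}) (E (p -` {w}) x) = (if v = w then E (p -` {v}) x else 0)" for v w
  proof -
    have "p -` {v} \<inter> p -` {w} = {}" if "v \<noteq> w" using that by auto
    then show ?thesis
      using E_Int[of "p -` {v}" "p -` {w}" x, symmetric] by (cases "v = w") simp_all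
  qed
  have "simple_spectral_integral E s (simple_spectral_integral E t x) =
      (\<Sum>v\<in>range p. fst v *\<^sub>C E (p -` {v}) (\<Sum>w\<in>range p. snd w *\<^sub>C E (p -` {w}) x))"
    using simple_integral_comp[OF p, of fst] simple_integral_comp[OF p, of snd]
    by (simp add: p_def)
  also have "\<dots> = (\<Sum>v\<in>range p. \<Sum>w\<in>range p. if v = w then (fst v * snd v) *\<^sub>C E (p -` {v}) x else 0)"
    by (intro sum.cong refl)
      (simp add: blinfun.sum_right scaleC_sum_right E_scaleC scaleC_scaleC orth if_distrib
        scaleC_zero_right cong: if_cong)
  also have "\<dots> = (\<Sum>v\<in>range p. (fst v * snd v) *\<^sub>C E (p -` {v}) x)"
    using fin by simp
  also have "\<dots> = simple_spectral_integral E (\<lambda>z. s z * t z) x"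
    using simple_integral_comp[OF p, of "\<lambda>v. fst v * snd v"] by (simp add: p_def)
  finally show "simple_spectral_integral E (\<lambda>z. s z * t z) x =
      (simple_spectral_integral E s o\<^sub>L simple_spectral_integral E t) x"
    by simp
qed

lemma simple_integral_const: "simple_spectral_integral E (\<lambda>_. a) x = a *\<^sub>C x"
  by (simp add: simple_integral_apply vimage_def)

lemma simple_integral_indicator:
  assumes "S \<in> sets borel"
  shows "simple_spectral_integral E (indicator S) x = E S x"
proof -
  have "simple_function borel (\<lambda>z. z \<in> S)"
    unfolding simple_function_def
  proof (intro conjI ballI)
    fix v
    have "(\<lambda>z. z \<in> S) -` {v} = (if v then S else - S)" by auto
    then show "(\<lambda>z. z \<in> S) -` {v} \<inter> space borel \<in> sets borel"
      using assms by (auto intro: borel_comp)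
  qed simp
  from simple_integral_comp[OF this, of of_bool x]
  have "simple_spectral_integral E (indicator S) x =
      (\<Sum>v\<in>range (\<lambda>z. z \<in> S). of_bool v *\<^sub>C E ((\<lambda>z. z \<in> S) -` {v}) x)"
    by (simp add: indicator_def[abs_def])
  \<comment> \<open>If \<open>S\<close> is empty or everything, one truth value is missing from the
    range; its preimage is empty and contributes zero.\<close>
  also have "\<dots> = (\<Sum>v\<in>UNIV. of_bool v *\<^sub>C E ((\<lambda>z. z \<in> S) -` {v}) x)"
  proof (rule sum.mono_neutral_left)
    have "(\<lambda>z. z \<in> S) -` {v} = {}" if "v \<notin> range (\<lambda>z. z \<in> S)" for v
      using that by auto
    then show "\<forall>v\<in>UNIV - range (\<lambda>z. z \<in> S). of_bool v *\<^sub>C E ((\<lambda>z. z \<in> S) -` {v}) x = 0"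
      by (simp add: scaleC_zero_right)
  qed auto
  also have "\<dots> = E S x"
    by (simp add: UNIV_bool vimage_def)
  finally show ?thesis .
qed

lemma norm_simple_integral_le:
  assumes s: "simple_function borel s" and c: "\<And>z. cmod (s z) \<le> c"
  shows "norm (simple_spectral_integral E s) \<le> 4 * bound * c"
proof (rule norm_blinfun_bound)
  have "0 \<le> c" using c[of 0] norm_ge_zero order.trans by blast
  then show "0 \<le> 4 * bound * c" using bound_nonneg by simp
  fix x
  have "norm (\<Sum>y\<in>range s. y *\<^sub>C E (s -` {y}) x) \<le> 4 * c * (bound * norm x)"
  proof (intro norm_sum_scaleC_le \<open>0 \<le> c\<close>)
    fix J assume "J \<subseteq> range s"
    then have "sum (\<lambda>y. E (s -` {y}) x) J = E (s -` J) x"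
      using E_simple_vimage[OF s] by simp
    also have "norm \<dots> \<le> norm (E (s -` J)) * norm x" by (rule norm_blinfun)
    also have "\<dots> \<le> bound * norm x"
      using simple_function_vimage_borel(2)[OF s] by (intro mult_right_mono norm_E_le) auto
    finally show "norm (sum (\<lambda>y. E (s -` {y}) x) J) \<le> bound * norm x" .
  qed (use c simple_function_vimage_borel(1)[OF s] in auto)
  then show "norm (simple_spectral_integral E s x) \<le> 4 * bound * c * norm x"
    by (simp add: simple_integral_apply algebra_simps)
qed

lemma simple_integral_diff:
  assumes "simple_function borel s" "simple_function borel t"
  shows "simple_spectral_integral E (\<lambda>z. s z - t z) =
    simple_spectral_integral E s - simple_spectral_integral E t"
  using simple_integral_add[of "\<lambda>z. s z - t z" t] assms by (simp add: simple_function_diff)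

text \<open>Two sequences at once: equal ones give convergence, different ones give independence of
  the approximation.\<close>

lemma simple_integral_Cauchy:
  assumes s: "\<And>n. simple_function borel (s n)" "uniform_limit UNIV s G sequentially"
    and t: "\<And>n. simple_function borel (t n)" "uniform_limit UNIV t G sequentially"
    and e: "e > 0"
  shows "\<exists>N. \<forall>m\<ge>N. \<forall>n\<ge>N. norm (simple_spectral_integral E (s m) - simple_spectral_integral E (t n)) < e"
proof -
  \<comment> \<open>Chosen so that 4 \<open>bound\<close> (2\<open>d\<close>) < \<open>e\<close>;
    the summand 1 keeps the denominator positive even if \<open>bound\<close> is 0.\<close>
  define d where "d = e / (2 * (4 * bound + 1))"
  have d: "d > 0" using e bound_nonneg by (simp add: d_def)
  obtain N1 where N1: "\<forall>n\<ge>N1. \<forall>z. dist (s n z) (G z) < d"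
    using s(2) d by (auto simp: uniform_limit_sequentially_iff)
  obtain N2 where N2: "\<forall>n\<ge>N2. \<forall>z. dist (t n z) (G z) < d"
    using t(2) d by (auto simp: uniform_limit_sequentially_iff)
  have "norm (simple_spectral_integral E (s m) - simple_spectral_integral E (t n)) < e"
    if "m \<ge> max N1 N2" "n \<ge> max N1 N2" for m n
  proof -
    have "cmod (s m z - t n z) \<le> 2 * d" for z
      using N1 N2 that dist_triangle2[of "s m z" "t n z" "G z"]
      by (simp add: dist_norm) (smt (verit))
    then have "norm (simple_spectral_integral E (\<lambda>z. s m z - t n z)) \<le> 4 * bound * (2 * d)"
      using s(1) t(1) by (intro norm_simple_integral_le simple_function_diff) auto
    also have "\<dots> < e" using e bound_nonneg by (simp add: d_def field_simps)
    finally show ?thesis using s(1) t(1) by (simp add: simple_integral_diff)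
  qed
  then show ?thesis by blast
qed

subsection \<open>Integrals of bounded Borel functions\<close>

abbreviation calc :: "(complex \<Rightarrow> complex) \<Rightarrow> 'a \<Rightarrow>\<^sub>L 'a" where
  "calc \<equiv> bounded_spectral_integral E"

text \<open>The approximating sequence supplied here keeps the condition inside \<open>THE\<close>
  from being vacuous, and its limit is the only candidate.\<close>

lemma calc_tendsto:
  assumes s: "\<And>n. simple_function borel (s n)" "uniform_limit UNIV s G sequentially"
  shows "(\<lambda>n. simple_spectral_integral E (s n)) \<longlonglongrightarrow> calc G"
proof -
  have "Cauchy (\<lambda>n. simple_spectral_integral E (s n))"
    using simple_integral_Cauchy[OF s s] by (auto simp: Cauchy_iff)
  then obtain T where T: "(\<lambda>n. simple_spectral_integral E (s n)) \<longlonglongrightarrow> T"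
    using convergent_eq_Cauchy by blast
  have all: "(\<lambda>n. simple_spectral_integral E (t n)) \<longlonglongrightarrow> T"
    if t: "\<forall>n. simple_function borel (t n)" "uniform_limit UNIV t G sequentially" for t
  proof -
    have "(\<lambda>n. simple_spectral_integral E (t n) - simple_spectral_integral E (s n)) \<longlonglongrightarrow> 0"
      unfolding LIMSEQ_iff using simple_integral_Cauchy[OF spec[OF t(1)] t(2) s]
      by simp blast
    from tendsto_add[OF this T] show ?thesis by simp
  qed
  have "calc G = T"
    unfolding bounded_spectral_integral_def
  proof (rule the_equality)
    fix T' assume "\<forall>s. (\<forall>n. simple_function borel (s n)) \<longrightarrow> uniform_limit UNIV s G sequentially \<longrightarrow>
      (\<lambda>n. simple_spectral_integral E (s n)) \<longlonglongrightarrow> T'"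
    with s have "(\<lambda>n. simple_spectral_integral E (s n)) \<longlonglongrightarrow> T'" by blast
    then show "T' = T" using T LIMSEQ_unique by blast
  qed (use all in blast)
  with T show ?thesis by simp
qed

lemma calc_simple: "simple_function borel s \<Longrightarrow> calc s = simple_spectral_integral E s"
  using calc_tendsto[of "\<lambda>_. s" s] by (simp add: LIMSEQ_const_iff uniform_limit_const)

definition bounded_borel :: "(complex \<Rightarrow> complex) \<Rightarrow> bool" where
  "bounded_borel G \<longleftrightarrow> G \<in> borel_measurable borel \<and> bounded (range G)"

lemma bounded_borelI:
  "G \<in> borel_measurable borel \<Longrightarrow> (\<And>z. cmod (G z) \<le> c) \<Longrightarrow> bounded_borel G"
  by (auto simp: bounded_borel_def intro!: boundedI)

lemma bounded_borelE:
  assumes "bounded_borel G"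
  obtains c where "G \<in> borel_measurable borel" "c > 0" "\<And>z. cmod (G z) \<le> c"
proof -
  from assms obtain c where "c > 0" "\<forall>x\<in>range G. cmod x \<le> c"
    unfolding bounded_borel_def bounded_pos by blast
  with assms show ?thesis
    by (intro that[of c]) (auto simp: bounded_borel_def)
qed

lemma bounded_borel_mult:
  assumes "bounded_borel G" "bounded_borel H"
  shows "bounded_borel (\<lambda>z. G z * H z)"
proof -
  obtain c d where "\<And>z. cmod (G z) \<le> c" "\<And>z. cmod (H z) \<le> d" "c > 0"
    using assms by (metis bounded_borelE)
  then have "cmod (G z * H z) \<le> c * d" for z
    unfolding norm_mult by (intro mult_mono) auto
  with assms show ?thesis
    by (intro bounded_borelI) (auto simp: bounded_borel_def)
qed

lemma bounded_borel_add:
  assumes "bounded_borel G" "bounded_borel H"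
  shows "bounded_borel (\<lambda>z. G z + H z)"
proof -
  obtain c d where "\<And>z. cmod (G z) \<le> c" "\<And>z. cmod (H z) \<le> d"
    using assms by (metis bounded_borelE)
  then have "cmod (G z + H z) \<le> c + d" for z
    by (intro norm_triangle_le add_mono)
  with assms show ?thesis
    by (intro bounded_borelI) (auto simp: bounded_borel_def)
qed

lemma bounded_borel_const: "bounded_borel (\<lambda>_. a)"
  by (rule bounded_borelI) auto

lemma bounded_borel_indicator: "S \<in> sets borel \<Longrightarrow> bounded_borel (indicator S)"
  by (rule bounded_borelI[where c = 1]) (auto simp: indicator_def)

lemma bounded_borel_restrict:
  assumes "G \<in> borel_measurable borel" "S \<in> sets borel" "\<And>z. z \<in> S \<Longrightarrow> cmod (G z) \<le> c"
  shows "bounded_borel (\<lambda>z. G z * indicator S z)"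
  using assms by (intro bounded_borelI[where c = "max 0 c"]) (auto simp: indicator_def le_max_iff_disj)

lemma simple_approximation:
  assumes "bounded_borel G"
  shows "\<exists>s. (\<forall>n. simple_function borel (s n)) \<and> uniform_limit UNIV s G sequentially"
proof -
  obtain c where [measurable]: "G \<in> borel_measurable borel" and c: "c > 0" "\<And>z. cmod (G z) \<le> c"
    using bounded_borelE[OF assms] by blast
  \<comment> \<open>Rounding down to the grid of width 1/(n+1). Bounded values meet only finitely
    many grid points, so rounding real and imaginary parts of \<open>G\<close> gives simple
    functions.\<close>
  define r where "r n x = real_of_int \<lfloor>real (Suc n) * x\<rfloor> / real (Suc n)" for n x
  have r_err: "\<bar>r n x - x\<bar> \<le> 1 / real (Suc n)" for n x
  proof -
    have "r n x - x = (real_of_int \<lfloor>real (Suc n) * x\<rfloor> - real (Suc n) * x) / real (Suc n)"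
      by (simp add: r_def field_simps)
    moreover have "\<bar>real_of_int \<lfloor>real (Suc n) * x\<rfloor> - real (Suc n) * x\<bar> \<le> 1" by linarith
    ultimately show ?thesis by (simp add: divide_right_mono)
  qed
  have r_fin: "finite (r n ` {-c..c})" for n
  proof -
    have "r n ` {-c..c} \<subseteq> (\<lambda>k. real_of_int k / real (Suc n)) ` {\<lfloor>real (Suc n) * (-c)\<rfloor>..\<lfloor>real (Suc n) * c\<rfloor>}"
    proof (rule image_subsetI)
      fix x assume "x \<in> {-c..c}"
      then have "real (Suc n) * (- c) \<le> real (Suc n) * x" "real (Suc n) * x \<le> real (Suc n) * c"
        using mult_left_mono[of "- c" x "real (Suc n)"] mult_left_mono[of x c "real (Suc n)"]
        by (simp_all del: of_nat_Suc)
      then show "r n x \<in> (\<lambda>k. real_of_int k / real (Suc n)) ` {\<lfloor>real (Suc n) * (-c)\<rfloor>..\<lfloor>real (Suc n) * c\<rfloor>}"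
        unfolding r_def by (intro imageI) (auto simp del: of_nat_Suc mult_minus_right intro: floor_mono)
    qed
    then show ?thesis by (rule finite_subset) simp
  qed
  define s where "s n z = Complex (r n (Re (G z))) (r n (Im (G z)))" for n z
  have s: "s n = (\<lambda>z. complex_of_real (r n (Re (G z))) + \<i> * complex_of_real (r n (Im (G z))))" for n
    by (simp add: s_def fun_eq_iff complex_eq_iff)
  have simple: "simple_function borel (s n)" for n
  proof (rule simple_function_borel_measurable)
    show "s n \<in> borel_measurable borel" unfolding s r_def by measurable
    have "s n z \<in> (\<lambda>(a, b). Complex a b) ` (r n ` {-c..c} \<times> r n ` {-c..c})" for z
    proof -
      have "Re (G z) \<in> {-c..c}" "Im (G z) \<in> {-c..c}"
        using c(2)[of z] abs_Re_le_cmod[of "G z"] abs_Im_le_cmod[of "G z"] by auto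
      then show ?thesis
        unfolding s_def
        by (intro image_eqI[where x = "(r n (Re (G z)), r n (Im (G z)))"] SigmaI imageI) simp_all
    qed
    then have "s n ` space borel \<subseteq> (\<lambda>(a, b). Complex a b) ` (r n ` {-c..c} \<times> r n ` {-c..c})"
      by (rule image_subsetI)
    then show "finite (s n ` space borel)"
      by (rule finite_subset) (intro finite_imageI finite_cartesian_product r_fin)
  qed
  have err: "dist (s n z) (G z) \<le> 2 / real (Suc n)" for n z
    using cmod_le[of "s n z - G z"] r_err[of n "Re (G z)"] r_err[of n "Im (G z)"]
    by (simp add: dist_norm s_def)
  have "uniform_limit UNIV s G sequentially"
  proof (rule uniform_limitI)
    fix e :: real assume "e > 0"
    have "(\<lambda>n. 2 / real (Suc n)) \<longlonglongrightarrow> 0"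
      using LIMSEQ_Suc[OF lim_const_over_n[of "2 :: real"]] by simp
    then have "\<forall>\<^sub>F n in sequentially. 2 / real (Suc n) < e"
      using \<open>e > 0\<close> by (rule order_tendstoD)
    then show "\<forall>\<^sub>F n in sequentially. \<forall>z\<in>UNIV. dist (s n z) (G z) < e"
      by (rule eventually_mono) (use err le_less_trans in blast)
  qed
  with simple show ?thesis by blast
qed

lemma calc_add:
  assumes "bounded_borel G" "bounded_borel H"
  shows "calc (\<lambda>z. G z + H z) = calc G + calc H"
proof -
  obtain s where s: "\<And>n. simple_function borel (s n)" "uniform_limit UNIV s G sequentially"
    using simple_approximation[OF assms(1)] by blast
  obtain t where t: "\<And>n. simple_function borel (t n)" "uniform_limit UNIV t H sequentially"
    using simple_approximation[OF assms(2)] by blast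
  have "(\<lambda>n. simple_spectral_integral E (\<lambda>z. s n z + t n z)) \<longlonglongrightarrow> calc (\<lambda>z. G z + H z)"
    using s t by (intro calc_tendsto simple_function_add uniform_limit_add)
  moreover have "(\<lambda>n. simple_spectral_integral E (\<lambda>z. s n z + t n z)) \<longlonglongrightarrow> calc G + calc H"
    unfolding simple_integral_add[OF s(1) t(1)] by (intro tendsto_add calc_tendsto s t)
  ultimately show ?thesis by (rule LIMSEQ_unique)
qed

lemma calc_mult:
  assumes "bounded_borel G" "bounded_borel H"
  shows "calc (\<lambda>z. G z * H z) x = calc G (calc H x)"
proof -
  obtain s where s: "\<And>n. simple_function borel (s n)" "uniform_limit UNIV s G sequentially"
    using simple_approximation[OF assms(1)] by blast
  obtain t where t: "\<And>n. simple_function borel (t n)" "uniform_limit UNIV t H sequentially"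
    using simple_approximation[OF assms(2)] by blast
  have "(\<lambda>n. simple_spectral_integral E (\<lambda>z. s n z * t n z)) \<longlonglongrightarrow> calc (\<lambda>z. G z * H z)"
    using s t assms
    by (intro calc_tendsto simple_function_mult uniform_lim_mult) (auto simp: bounded_borel_def)
  moreover have "(\<lambda>n. simple_spectral_integral E (\<lambda>z. s n z * t n z)) \<longlonglongrightarrow> (calc G o\<^sub>L calc H)"
    unfolding simple_integral_mult[OF s(1) t(1)]
    by (intro bounded_bilinear.tendsto[OF bounded_bilinear_blinfun_compose] calc_tendsto s t)
  ultimately have "calc (\<lambda>z. G z * H z) = calc G o\<^sub>L calc H" by (rule LIMSEQ_unique)
  then show ?thesis by simp
qed

lemma norm_calc_le:
  assumes "G \<in> borel_measurable borel" and c: "\<And>z. cmod (G z) \<le> c"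
  shows "norm (calc G) \<le> 4 * bound * c"
proof -
  obtain s where s: "\<And>n. simple_function borel (s n)" "uniform_limit UNIV s G sequentially"
    using simple_approximation[OF bounded_borelI[OF assms]] by blast
  \<comment> \<open>The approximants may exceed \<open>c\<close> slightly, so the estimate is first
    shown with slack \<open>e\<close>, which then tends to 0.\<close>
  have "norm (calc G) \<le> 4 * bound * (c + e)" if "e > 0" for e
  proof (rule tendsto_upperbound[OF tendsto_norm[OF calc_tendsto[OF s]]])
    have "\<forall>\<^sub>F n in sequentially. \<forall>z\<in>UNIV. dist (s n z) (G z) < e"
      using uniform_limitD[OF s(2)] that by blast
    then show "\<forall>\<^sub>F n in sequentially. norm (simple_spectral_integral E (s n)) \<le> 4 * bound * (c + e)"
    proof (rule eventually_mono)
      fix n assume n: "\<forall>z\<in>UNIV. dist (s n z) (G z) < e"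
      have "cmod (s n z) \<le> c + e" for z
        using n[THEN bspec, of z] c[of z] norm_triangle_sub[of "s n z" "G z"] by (simp add: dist_norm)
      then show "norm (simple_spectral_integral E (s n)) \<le> 4 * bound * (c + e)"
        by (intro norm_simple_integral_le s)
    qed
  qed simp
  then have "\<forall>\<^sub>F e in at_right 0. norm (calc G) \<le> 4 * bound * (c + e)"
    by (auto simp: eventually_at_right_less eventually_at_filter)
  moreover have "((\<lambda>e. 4 * bound * (c + e)) \<longlongrightarrow> 4 * bound * (c + 0)) (at_right 0)"
    by (intro tendsto_intros)
  ultimately show ?thesis
    using tendsto_lowerbound[of _ _ "at_right (0::real)" "norm (calc G)"] by simp
qed

lemma calc_const: "calc (\<lambda>_. a) x = a *\<^sub>C x"
  by (simp add: calc_simple simple_integral_const)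

lemma calc_indicator: "S \<in> sets borel \<Longrightarrow> calc (indicator S) x = E S x"
  by (simp add: calc_simple simple_integral_indicator)

text \<open>\<open>E S\<close> is the integral of the indicator, so both forms are multiplicativity.
  Together they show that \<open>E S\<close> commutes with \<open>calc G\<close>.\<close>

lemma calc_restrict:
  assumes "bounded_borel G" "S \<in> sets borel"
  shows "calc (\<lambda>z. G z * indicator S z) x = calc G (E S x)"
    and "calc (\<lambda>z. G z * indicator S z) x = E S (calc G x)"
  using calc_mult[OF assms(1) bounded_borel_indicator[OF assms(2)], of x]
    calc_mult[OF bounded_borel_indicator[OF assms(2)] assms(1), of x] assms(2)
  by (simp_all add: calc_indicator mult.commute)


subsection \<open>Integrals of unbounded Borel functions\<close>

text \<open>Along an exhaustion the projections tend strongly to the identity, so a vector is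
  determined by its localisations.\<close>

lemma E_exhaustion_eqI:
  assumes S: "\<And>k::nat. S k \<in> sets borel" "incseq S" "(\<Union>k. S k) = UNIV"
    and eq: "\<And>k. E (S k) x = E (S k) y"
  shows "x = y"
proof -
  have "(\<lambda>k. E (S k) x) \<longlonglongrightarrow> x" "(\<lambda>k. E (S k) y) \<longlonglongrightarrow> y"
    using E_incseq[OF S(1,2)] S(3) by auto
  then show ?thesis unfolding eq by (rule LIMSEQ_unique)
qed

lemma sublevel_exhaustion:
  assumes "G \<in> borel_measurable borel"
  shows "{w. cmod (G w) \<le> real n} \<in> sets borel"
    and "incseq (\<lambda>n. {w. cmod (G w) \<le> real n})"
    and "(\<Union>n. {w. cmod (G w) \<le> real n}) = UNIV"
proof -
  show "{w. cmod (G w) \<le> real n} \<in> sets borel"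
    using assms by measurable
  show "incseq (\<lambda>n. {w. cmod (G w) \<le> real n})"
    by (auto simp: incseq_def intro: order.trans)
  show "(\<Union>n. {w. cmod (G w) \<le> real n}) = UNIV"
    using real_arch_simple by auto
qed

lemma ball_exhaustion:
  shows "cball 0 (real n) \<in> sets borel"
    and "incseq (\<lambda>n. cball (0::complex) (real n))"
    and "(\<Union>n. cball (0::complex) (real n)) = UNIV"
  using real_arch_simple by (auto simp: incseq_def intro: order.trans)

text \<open>Once n exceeds \<open>c\<close>, truncation at level n leaves \<open>G\<close> unchanged
  on \<open>S\<close>, so the localised approximants are eventually constant.\<close>

lemma spectral_integral_SomeD:
  assumes some: "spectral_integral E G f = Some y"
    and G: "G \<in> borel_measurable borel" and S: "S \<in> sets borel"
    and c: "\<And>z. z \<in> S \<Longrightarrow> cmod (G z) \<le> c"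
  shows "E S y = calc (\<lambda>z. G z * indicator S z) f"
proof -
  define I where "I n = calc (truncation G n) f" for n
  have "convergent I" "lim I = y"
    using some unfolding spectral_integral_def Let_def I_def by (auto split: if_splits)
  then have "I \<longlonglongrightarrow> y" by (simp add: convergent_LIMSEQ_iff)
  then have lim: "(\<lambda>n. E S (I n)) \<longlonglongrightarrow> E S y" by (intro tendsto_intros)
  obtain N where N: "c \<le> real N" using real_arch_simple by blast
  have "E S (I n) = calc (\<lambda>z. G z * indicator S z) f" if "n \<ge> N" for n
  proof -
    have "bounded_borel (truncation G n)"
      unfolding truncation_def using sublevel_exhaustion(1)[OF G]
      by (intro bounded_borel_restrict[OF G]) auto
    then have "E S (I n) = calc (\<lambda>z. truncation G n z * indicator S z) f"
      unfolding I_def using S by (simp add: calc_restrict(2))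
    also have "(\<lambda>z. truncation G n z * indicator S z) = (\<lambda>z. G z * indicator S z)"
    proof
      fix z
      have "z \<in> S \<Longrightarrow> cmod (G z) \<le> real n" using c[of z] N that by linarith
      then show "truncation G n z * indicator S z = G z * indicator S z"
        by (auto simp: truncation_def indicator_def)
    qed
    finally show ?thesis .
  qed
  then have "(\<lambda>n. E S (I n)) \<longlonglongrightarrow> calc (\<lambda>z. G z * indicator S z) f"
    by (intro tendsto_eventually eventually_sequentiallyI)
  with lim show ?thesis by (rule LIMSEQ_unique)
qed

text \<open>The integral is defined through the sublevel sets of \<open>G\<close>, but any
  exhaustion on which \<open>G\<close> is bounded can certify its value. This gives the freedom to
  choose sets adapted to several functions.\<close>

lemma spectral_integral_SomeI:
  assumes G: "G \<in> borel_measurable borel"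
    and S: "\<And>k::nat. S k \<in> sets borel" "incseq S" "(\<Union>k. S k) = UNIV"
    and c: "\<And>k z. z \<in> S k \<Longrightarrow> cmod (G z) \<le> c k"
    and eq: "\<And>k. E (S k) y = calc (\<lambda>z. G z * indicator (S k) z) f"
  shows "spectral_integral E G f = Some y"
proof -
  define L where "L n = {w. cmod (G w) \<le> real n}" for n
  note L = sublevel_exhaustion[OF G, folded L_def]
  \<comment> \<open>Tested on each \<open>S k\<close>, the truncated integral is the localisation of
    \<open>y\<close> to the sublevel set, and these localisations tend to \<open>y\<close>.\<close>
  have "calc (truncation G n) f = E (L n) y" for n
  proof (rule E_exhaustion_eqI[OF S])
    fix k
    have "bounded_borel (truncation G n)"
      unfolding truncation_def using L by (intro bounded_borel_restrict[OF G]) (auto simp: L_def)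
    then have "E (S k) (calc (truncation G n) f) = calc (\<lambda>z. truncation G n z * indicator (S k) z) f"
      using S by (simp add: calc_restrict(2))
    also have "\<dots> = calc (\<lambda>z. G z * indicator (S k) z * indicator (L n) z) f"
      by (simp add: truncation_def L_def mult_ac)
    also have "\<dots> = E (L n) (E (S k) y)"
      unfolding eq using S L c by (intro calc_restrict bounded_borel_restrict[OF G]) auto
    also have "\<dots> = E (S k) (E (L n) y)"
      using S L by (simp flip: E_Int add: Int_commute)
    finally show "E (S k) (calc (truncation G n) f) = E (S k) (E (L n) y)" .
  qed
  moreover have "(\<lambda>n. E (L n) y) \<longlonglongrightarrow> y"
    using E_incseq[of L y] L by simp
  ultimately have "(\<lambda>n. calc (truncation G n) f) \<longlonglongrightarrow> y" by simp
  then show ?thesis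
    unfolding spectral_integral_def Let_def by (auto simp: limI convergentI)
qed

text \<open>On a sublevel set of \<open>H\<close> all functions involved are bounded, and there the
  identity is additivity and multiplicativity of \<open>calc\<close>.\<close>

lemma spectral_integral_combination:
  assumes some: "spectral_integral E H f = Some y" and H: "H \<in> borel_measurable borel"
    and \<phi>: "bounded_borel \<phi>" and \<psi>: "bounded_borel \<psi>"
  shows "spectral_integral E (\<lambda>z. \<phi> z * H z + \<psi> z) f = Some (calc \<phi> y + calc \<psi> f)"
proof -
  define S where "S n = {w. cmod (H w) \<le> real n}" for n
  note S = sublevel_exhaustion[OF H, folded S_def]
  obtain c d where cd: "\<And>z. cmod (\<phi> z) \<le> c" "\<And>z. cmod (\<psi> z) \<le> d" "c > 0"
    using \<phi> \<psi> by (metis bounded_borelE)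
  show ?thesis
  proof (rule spectral_integral_SomeI[OF _ S])
    show "(\<lambda>z. \<phi> z * H z + \<psi> z) \<in> borel_measurable borel"
      using \<phi> \<psi> H by (auto simp: bounded_borel_def)
    show "cmod (\<phi> z * H z + \<psi> z) \<le> c * real k + d" if "z \<in> S k" for z k
    proof (intro norm_triangle_le add_mono)
      show "cmod (\<phi> z * H z) \<le> c * real k"
        unfolding norm_mult using that cd by (intro mult_mono) (auto simp: S_def)
    qed (rule cd)
    fix k
    have H': "bounded_borel (\<lambda>z. H z * indicator (S k) z)"
      using S by (intro bounded_borel_restrict[OF H]) (auto simp: S_def)
    have "E (S k) (calc \<phi> y + calc \<psi> f) = calc \<phi> (E (S k) y) + calc (\<lambda>z. \<psi> z * indicator (S k) z) f"
      using S \<phi> \<psi> by (simp add: blinfun.add_right flip: calc_restrict)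
    also have "E (S k) y = calc (\<lambda>z. H z * indicator (S k) z) f"
      using S by (intro spectral_integral_SomeD[OF some H]) (auto simp: S_def)
    also have "calc \<phi> (calc (\<lambda>z. H z * indicator (S k) z) f) + calc (\<lambda>z. \<psi> z * indicator (S k) z) f =
        calc (\<lambda>z. \<phi> z * (H z * indicator (S k) z) + \<psi> z * indicator (S k) z) f"
      using \<phi> \<psi> H' S
      by (simp add: calc_add calc_mult bounded_borel_mult bounded_borel_indicator blinfun.add_left)
    also have "\<dots> = calc (\<lambda>z. (\<phi> z * H z + \<psi> z) * indicator (S k) z) f"
      by (simp add: algebra_simps)
    finally show "E (S k) (calc \<phi> y + calc \<psi> f) = calc (\<lambda>z. (\<phi> z * H z + \<psi> z) * indicator (S k) z) f" .
  qed
qed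

text \<open>Where |H| >= 1 the quotient G/H is bounded by 2C, and elsewhere \<open>G\<close> itself
  is; so G = \<phi> H + \<psi> with bounded coefficients.\<close>

lemma dom_spectral_integral_mono:
  assumes G[measurable]: "G \<in> borel_measurable borel" and H[measurable]: "H \<in> borel_measurable borel"
    and le: "\<And>z. cmod (G z) \<le> C * (1 + cmod (H z))"
  shows "dom (spectral_integral E H) \<subseteq> dom (spectral_integral E G)"
proof
  fix f assume "f \<in> dom (spectral_integral E H)"
  then obtain y where y: "spectral_integral E H f = Some y" by auto
  define \<phi> where "\<phi> z = (if 1 \<le> cmod (H z) then G z / H z else 0)" for z
  define \<psi> where "\<psi> z = (if 1 \<le> cmod (H z) then 0 else G z)" for z
  \<comment> \<open>The sign of \<open>C\<close> is read off from the hypothesis at a single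
    point.\<close>
  have "0 \<le> C * (1 + cmod (H 0))" using le[of 0] norm_ge_zero order.trans by blast
  then have C: "0 \<le> C" using norm_ge_zero[of "H 0"] by (simp add: zero_le_mult_iff)
  have "cmod (\<phi> z) \<le> 2 * C" for z
  proof (cases "1 \<le> cmod (H z)")
    case True
    have "cmod (G z) \<le> C * (1 + cmod (H z))" by (rule le)
    also have "\<dots> \<le> C * (cmod (H z) + cmod (H z))" using True C by (intro mult_left_mono) auto
    finally show ?thesis using True C by (auto simp: \<phi>_def norm_divide divide_le_eq)
  qed (use C in \<open>simp add: \<phi>_def\<close>)
  moreover have "\<phi> \<in> borel_measurable borel" unfolding \<phi>_def by measurable
  ultimately have \<phi>: "bounded_borel \<phi>" by (intro bounded_borelI)
  have "cmod (\<psi> z) \<le> 2 * C" for z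
  proof (cases "1 \<le> cmod (H z)")
    case False
    have "cmod (G z) \<le> C * (1 + cmod (H z))" by (rule le)
    also have "\<dots> \<le> C * (1 + 1)" using False C by (intro mult_left_mono) auto
    finally show ?thesis using False by (simp add: \<psi>_def)
  qed (use C in \<open>simp add: \<psi>_def\<close>)
  moreover have "\<psi> \<in> borel_measurable borel" unfolding \<psi>_def by measurable
  ultimately have \<psi>: "bounded_borel \<psi>" by (intro bounded_borelI)
  have "(\<lambda>z. \<phi> z * H z + \<psi> z) = G" by (auto simp: \<phi>_def \<psi>_def)
  then show "f \<in> dom (spectral_integral E G)"
    using spectral_integral_combination[OF y H \<phi> \<psi>] by auto
qed

section \<open>Powers of the operator\<close>

abbreviation op :: "'a \<rightharpoonup> 'a" where
  "op \<equiv> spectral_integral E (\<lambda>z. z)"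

lemma bounded_borel_power_ball: "bounded_borel (\<lambda>z. z ^ n * indicator (cball 0 (real k)) z)"
proof (rule bounded_borel_restrict)
  fix z :: complex assume "z \<in> cball 0 (real k)"
  then show "cmod (z ^ n) \<le> real k ^ n"
    unfolding norm_power by (intro power_mono) auto
qed auto

text \<open>The balls serve all exponents simultaneously, so relations between different powers
  become identities of the bounded calculus on each ball.\<close>

lemma spectral_integral_power_iff:
  "spectral_integral E (\<lambda>z. z ^ n) f = Some y \<longleftrightarrow>
    (\<forall>k. E (cball 0 (real k)) y = calc (\<lambda>z. z ^ n * indicator (cball 0 (real k)) z) f)"
proof -
  have *: "cmod (z ^ n) \<le> real k ^ n" if "z \<in> cball 0 (real k)" for z :: complex and k
    unfolding norm_power using that by (intro power_mono) auto
  show ?thesis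
  proof (intro iffI allI)
    fix k
    assume "spectral_integral E (\<lambda>z. z ^ n) f = Some y"
    then show "E (cball 0 (real k)) y = calc (\<lambda>z. z ^ n * indicator (cball 0 (real k)) z) f"
      by (rule spectral_integral_SomeD[OF _ _ _ *]) auto
  next
    assume "\<forall>k. E (cball 0 (real k)) y = calc (\<lambda>z. z ^ n * indicator (cball 0 (real k)) z) f"
    then show "spectral_integral E (\<lambda>z. z ^ n) f = Some y"
      by (intro spectral_integral_SomeI[OF _ ball_exhaustion *]) auto
  qed
qed

lemma calc_Suc_power:
  fixes k :: nat
  assumes "E (cball 0 (real k)) u = calc (\<lambda>z. z ^ n * indicator (cball 0 (real k)) z) f"
  shows "calc (\<lambda>z. z * indicator (cball 0 (real k)) z) u =
    calc (\<lambda>z. z ^ Suc n * indicator (cball 0 (real k)) z) f"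
proof -
  let ?S = "cball 0 (real k) :: complex set"
  have b: "bounded_borel (\<lambda>z. z * indicator ?S z)"
    using bounded_borel_power_ball[of 1 k] by simp
  \<comment> \<open>Doubling the idempotent indicator splits off \<open>E ?S u\<close>, the only
    information available about \<open>u\<close>.\<close>
  have "calc (\<lambda>z. z * indicator ?S z) u = calc (\<lambda>z. z * indicator ?S z * indicator ?S z) u"
    by (simp add: mult.assoc flip: indicator_inter_arith)
  also have "\<dots> = calc (\<lambda>z. z * indicator ?S z) (E ?S u)"
    by (intro calc_restrict b) auto
  also have "\<dots> = calc (\<lambda>z. (z * indicator ?S z) * (z ^ n * indicator ?S z)) f"
    unfolding assms by (intro calc_mult[symmetric] b bounded_borel_power_ball)
  also have "(\<lambda>z. (z * indicator ?S z) * (z ^ n * indicator ?S z)) = (\<lambda>z. z ^ Suc n * indicator ?S z)"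
    by (auto simp: indicator_def)
  finally show ?thesis .
qed

lemma spectral_integral_one: "spectral_integral E (\<lambda>z. z ^ 0) f = Some f"
  by (simp add: spectral_integral_power_iff[of 0, simplified] calc_indicator)

lemma spectral_integral_Suc_power:
  assumes "spectral_integral E (\<lambda>z. z ^ n) f = Some u"
  shows "spectral_integral E (\<lambda>z. z ^ Suc n) f = Some y \<longleftrightarrow> op u = Some y"
proof -
  have "calc (\<lambda>z. z * indicator (cball 0 (real k)) z) u =
      calc (\<lambda>z. z ^ Suc n * indicator (cball 0 (real k)) z) f" for k
    using assms by (intro calc_Suc_power) (simp only: spectral_integral_power_iff)
  then show ?thesis
    using spectral_integral_power_iff[of 1 u y]
    by (simp only: spectral_integral_power_iff power_one_right)
qed

lemma spectral_integral_power_if_op_power: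
  assumes "op_power op n f = Some y"
  shows "spectral_integral E (\<lambda>z. z ^ n) f = Some y"
  using assms
proof (induction n arbitrary: y)
  case 0
  then show ?case using spectral_integral_one by simp
next
  case (Suc n)
  then obtain u where "op_power op n f = Some u" "op u = Some y"
    by (auto simp: map_comp_Some_iff)
  with Suc.IH show ?case by (simp only: spectral_integral_Suc_power)
qed

text \<open>A composed power is defined only if the lower ones are. Assuming every exponent supplies
  each intermediate vector, and matches the form of \<open>C_infinity\<close>.\<close>

lemma op_power_if_spectral_integral_power:
  assumes "\<And>n. spectral_integral E (\<lambda>z. z ^ n) f = Some (y n)"
  shows "op_power op n f = Some (y n)"
proof (induction n)
  case 0
  then show ?case using assms[of 0] spectral_integral_one[of f] by simp
next
  case (Suc n)
  then show ?case
    using spectral_integral_Suc_power[OF assms[of n], of "y (Suc n)"] assms[of "Suc n"]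
    by (simp add: map_comp_Some_iff)
qed

section \<open>Finite sums and uniform limits in the bounded calculus\<close>

lemma calc_sum:
  assumes "finite I" "\<And>i. i \<in> I \<Longrightarrow> bounded_borel (g i)"
  shows "bounded_borel (\<lambda>z. \<Sum>i\<in>I. g i z) \<and> calc (\<lambda>z. \<Sum>i\<in>I. g i z) f = (\<Sum>i\<in>I. calc (g i) f)"
  using assms
proof (induction I rule: finite_induct)
  case empty
  then show ?case by (simp add: bounded_borel_const calc_const)
next
  case (insert k I)
  then show ?case by (simp add: bounded_borel_add calc_add blinfun.add_left)
qed

lemma calc_scaleR_mult:
  assumes "bounded_borel G"
  shows "calc (\<lambda>z. complex_of_real a * G z) f = a *\<^sub>R calc G f"
  using calc_mult[OF bounded_borel_const assms] by (simp add: calc_const scaleC_of_real)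

lemma calc_diff:
  assumes G: "bounded_borel G" and H: "bounded_borel H"
  shows "calc (\<lambda>z. G z - H z) f = calc G f - calc H f"
proof -
  have "bounded_borel (\<lambda>z. complex_of_real (-1) * H z)"
    by (intro bounded_borel_mult bounded_borel_const H)
  from calc_add[OF G this] show ?thesis
    using calc_scaleR_mult[OF H, of "-1" f] by (simp add: blinfun.add_left)
qed

lemma calc_uniform_limit:
  assumes g: "\<And>n. bounded_borel (g n)" and G: "bounded_borel G"
    and le: "\<And>n z. cmod (g n z - G z) \<le> e n" and e: "e \<longlonglongrightarrow> 0"
  shows "(\<lambda>n. calc (g n) f) \<longlonglongrightarrow> calc G f"
proof (rule LIM_zero_cancel, rule Lim_null_comparison)
  have "norm (calc (g n) f - calc G f) \<le> 4 * bound * e n * norm f" for n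
  proof -
    have "(\<lambda>z. g n z - G z) \<in> borel_measurable borel"
      using g[of n] G by (simp add: bounded_borel_def borel_measurable_diff)
    then have "norm (calc (\<lambda>z. g n z - G z)) * norm f \<le> 4 * bound * e n * norm f"
      by (intro mult_right_mono norm_calc_le le) auto
    then show ?thesis
      using norm_blinfun[of "calc (\<lambda>z. g n z - G z)" f] by (simp add: calc_diff g G)
  qed
  then show "\<forall>\<^sub>F n in sequentially. norm (calc (g n) f - calc G f) \<le> 4 * bound * e n * norm f"
    by (intro always_eventually allI)
  show "(\<lambda>n. 4 * bound * e n * norm f) \<longlonglongrightarrow> 0"
    using tendsto_mult[OF tendsto_mult[OF tendsto_const e] tendsto_const, of "4 * bound" "norm f"]
    by simp
qed

end

subsection \<open>Carleman classes\<close>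

locale growth_sequence =
  fixes m :: "nat \<Rightarrow> real"
  assumes pos: "\<And>n. m n > 0"
    and growth: "\<And>\<alpha>. \<alpha> > 0 \<Longrightarrow> \<exists>c>0. \<forall>n. c * \<alpha> ^ n \<le> m n"
begin

abbreviation T :: "real \<Rightarrow> real" where
  "T \<equiv> T_function m"

lemma summable: "summable (\<lambda>n. x ^ n / m n)"
proof -
  obtain c where c: "c > 0" "\<And>n. c * (\<bar>x\<bar> + 1) ^ n \<le> m n"
    using growth[of "\<bar>x\<bar> + 1"] by force
  have le: "norm (x ^ n / m n) \<le> (1 / c) * (\<bar>x\<bar> / (\<bar>x\<bar> + 1)) ^ n" for n
  proof -
    have "norm (x ^ n / m n) = \<bar>x\<bar> ^ n / m n"
      using pos[of n] by (simp add: power_abs)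
    also have "\<dots> \<le> \<bar>x\<bar> ^ n / (c * (\<bar>x\<bar> + 1) ^ n)"
      using c pos by (intro divide_left_mono mult_pos_pos) auto
    finally show ?thesis by (simp add: power_divide)
  qed
  have "summable (\<lambda>n. (1 / c) * (\<bar>x\<bar> / (\<bar>x\<bar> + 1)) ^ n)"
    by (intro summable_mult summable_geometric) auto
  then show ?thesis
    by (rule summable_comparison_test'[where N = 0]) (rule le)
qed

lemma T_minus_partial_sum:
  "T x - m 0 * (\<Sum>n<N. x ^ n / m n) = m 0 * (\<Sum>n. x ^ (n + N) / m (n + N))"
  unfolding T_function_def suminf_minus_initial_segment[OF summable] by (simp add: algebra_simps)

text \<open>Remainders have nonnegative coefficients and so increase with the argument: the
  remainder at the radius of a ball controls the error on the whole ball. The case N = 0 concerns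
  \<open>T\<close> itself.\<close>

lemma T_minus_partial_sum_bounds:
  assumes "0 \<le> x" "x \<le> y"
  shows "0 \<le> T x - m 0 * (\<Sum>n<N. x ^ n / m n)"
    and "T x - m 0 * (\<Sum>n<N. x ^ n / m n) \<le> T y - m 0 * (\<Sum>n<N. y ^ n / m n)"
proof -
  note sm = summable_ignore_initial_segment[OF summable, of _ N]
  have "0 \<le> (\<Sum>n. x ^ (n + N) / m (n + N))"
    using assms pos by (intro suminf_nonneg sm) (simp add: less_imp_le)
  then show "0 \<le> T x - m 0 * (\<Sum>n<N. x ^ n / m n)"
    unfolding T_minus_partial_sum using pos[of 0] by simp
  have "(\<Sum>n. x ^ (n + N) / m (n + N)) \<le> (\<Sum>n. y ^ (n + N) / m (n + N))"
    using assms pos by (intro suminf_le sm) (auto intro!: divide_right_mono power_mono simp: less_imp_le)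
  then show "T x - m 0 * (\<Sum>n<N. x ^ n / m n) \<le> T y - m 0 * (\<Sum>n<N. y ^ n / m n)"
    unfolding T_minus_partial_sum using pos[of 0] by simp
qed

lemma T_mono: "0 \<le> x \<Longrightarrow> x \<le> y \<Longrightarrow> T x \<le> T y"
  using T_minus_partial_sum_bounds(2)[of x y 0] by simp

lemma T_nonneg: "0 \<le> x \<Longrightarrow> 0 \<le> T x"
  using T_minus_partial_sum_bounds(1)[of x x 0] by simp

lemma T_ge_term:
  assumes "0 \<le> x"
  shows "m 0 * x ^ n / m n \<le> T x"
proof -
  have "0 \<le> m 0 * (\<Sum>k<n. x ^ k / m k)"
    using assms pos by (intro mult_nonneg_nonneg sum_nonneg) (auto simp: less_imp_le)
  moreover have "m 0 * (\<Sum>k<Suc n. x ^ k / m k) \<le> T x"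
    using T_minus_partial_sum_bounds(1)[of x x "Suc n"] assms by simp
  ultimately show ?thesis by (simp add: algebra_simps)
qed

lemma T_ge_1: "0 \<le> x \<Longrightarrow> 1 \<le> T x"
  using T_ge_term[of x 0] pos[of 0] by simp

lemma continuous_T: "continuous_on S T"
proof -
  have "isCont (\<lambda>x. \<Sum>n. inverse (m n) * x ^ n) x" for x :: real
  proof (rule isCont_powser)
    show "summable (\<lambda>n. inverse (m n) * (\<bar>x\<bar> + 1) ^ n)"
      using summable[of "\<bar>x\<bar> + 1"] by (simp add: field_simps)
  qed auto
  then have "isCont T x" for x
    unfolding T_function_def[abs_def] by (intro continuous_intros) (simp add: field_simps)
  then show ?thesis by (simp add: continuous_at_imp_continuous_on)
qed

lemma T_partial_sum_tendsto: "(\<lambda>N. T x - m 0 * (\<Sum>n<N. x ^ n / m n)) \<longlonglongrightarrow> 0"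
  using tendsto_diff[OF tendsto_const tendsto_mult[OF tendsto_const summable_LIMSEQ[OF summable]],
    of "T x" "m 0" x] by (simp add: T_function_def)

end

lemma measurable_radial:
  fixes F :: "real \<Rightarrow> real"
  assumes "continuous_on {0..} F" "0 \<le> t"
  shows "(\<lambda>z. complex_of_real (F (t * cmod z))) \<in> borel_measurable borel"
proof (rule borel_measurable_continuous_onI)
  have "continuous_on UNIV (\<lambda>z::complex. F (t * cmod z))"
    using assms(2) by (intro continuous_on_compose2[OF assms(1)] continuous_intros) auto
  then show "continuous_on UNIV (\<lambda>z::complex. complex_of_real (F (t * cmod z)))"
    by (intro continuous_intros)
qed

section \<open>Carleman classes as domains of T(t|A|)\<close>

locale spectral_growth = spectral E + growth_sequence m
  for E :: "complex set \<Rightarrow> 'a::complex_banach \<Rightarrow>\<^sub>L 'a" and m :: "nat \<Rightarrow> real"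
begin

abbreviation radial :: "(real \<Rightarrow> real) \<Rightarrow> real \<Rightarrow> 'a \<rightharpoonup> 'a" where
  "radial F t \<equiv> spectral_integral E (\<lambda>z. complex_of_real (F (t * cmod z)))"

text \<open>With \<open>w = T(t|A|)f\<close>, one has \<open>A\<^sup>nf = \<phi>\<^sub>n(A)w\<close> for
  \<open>\<phi>\<^sub>n(z) = z\<^sup>n / T(t|z|)\<close>, and \<open>|\<phi>\<^sub>n| \<le> m\<^sub>n / (m\<^sub>0t\<^sup>n)\<close>.\<close>

lemma dom_radial_T_imp_growth:
  assumes f: "f \<in> dom (radial T t)" and t: "t > 0"
  shows "f \<in> C_infinity op \<and> (\<exists>c>0. \<forall>n. norm (the (op_power op n f)) \<le> c * (1 / t) ^ n * m n)"
proof -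
  define H where "H z = complex_of_real (T (t * cmod z))" for z
  have [measurable]: "H \<in> borel_measurable borel"
    unfolding H_def using continuous_T t by (intro measurable_radial) auto
  obtain w where w: "spectral_integral E H f = Some w" using f by (auto simp: H_def[abs_def])
  define \<phi> where "\<phi> n z = z ^ n / H z" for n z
  have H0: "cmod (H z) = T (t * cmod z)" "H z \<noteq> 0" for z
    using T_ge_1[of "t * cmod z"] t by (auto simp: H_def)
  have \<phi>_meas: "\<phi> n \<in> borel_measurable borel" for n unfolding \<phi>_def by measurable
  have \<phi>_le: "cmod (\<phi> n z) \<le> m n / (m 0 * t ^ n)" for n z
  proof -
    have "m 0 * (t * cmod z) ^ n / m n \<le> T (t * cmod z)"
      using t by (intro T_ge_term) auto
    moreover have "0 < T (t * cmod z)" using T_ge_1[of "t * cmod z"] t by simp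
    ultimately show ?thesis
      using t pos[of n] pos[of 0]
      by (simp add: \<phi>_def norm_divide norm_power H0 power_mult_distrib field_simps)
  qed
  define y where "y n = calc (\<phi> n) w" for n
  have "spectral_integral E (\<lambda>z. z ^ n) f = Some (y n)" for n
  proof -
    have "(\<lambda>z. z ^ n) = (\<lambda>z. \<phi> n z * H z + 0)" using H0 by (simp add: \<phi>_def fun_eq_iff)
    then show ?thesis
      using spectral_integral_combination[OF w _ bounded_borelI[OF \<phi>_meas \<phi>_le] bounded_borel_const[of 0]]
      by (simp add: y_def calc_const)
  qed
  then have pow: "op_power op n f = Some (y n)" for n
    by (rule op_power_if_spectral_integral_power)
  \<comment> \<open>The summand 1 makes the constant strictly positive even when \<open>w\<close> is
    0.\<close>
  define c where "c = 4 * bound * norm w / m 0 + 1"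
  have "norm (y n) \<le> c * (1 / t) ^ n * m n" for n
  proof -
    have "norm (y n) \<le> norm (calc (\<phi> n)) * norm w" unfolding y_def by (rule norm_blinfun)
    also have "\<dots> \<le> 4 * bound * (m n / (m 0 * t ^ n)) * norm w"
      by (intro mult_right_mono norm_calc_le \<phi>_meas \<phi>_le) auto
    also have "\<dots> = (c - 1) * (1 / t) ^ n * m n"
      by (simp add: c_def power_divide)
    also have "\<dots> \<le> c * (1 / t) ^ n * m n"
      using t pos[of n] by (intro mult_right_mono) auto
    finally show ?thesis .
  qed
  moreover have "c > 0" using bound_nonneg pos[of 0] by (auto simp: c_def intro!: add_nonneg_pos)
  moreover have "f \<in> C_infinity op" using pow by (simp add: C_infinity_def domI)
  ultimately show ?thesis using pow by (intro conjI exI[of _ c]) simp_all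
qed

text \<open>Writing \<open>|z|\<^sup>n = u(z)\<^sup>nz\<^sup>n\<close> with \<open>u(z) = cnj (sgn z)\<close> bounded, \<open>T(t|A|)f\<close> is the absolutely
  convergent series of the vectors \<open>(m\<^sub>0t\<^sup>n/m\<^sub>n) u(A)\<^sup>nA\<^sup>nf\<close>.\<close>

lemma growth_imp_dom_radial_T:
  assumes f: "f \<in> C_infinity op" and le: "\<And>n. norm (the (op_power op n f)) \<le> c * \<alpha> ^ n * m n"
    and t: "t > 0" and \<alpha>: "\<alpha> > 0" "t * \<alpha> < 1"
  shows "f \<in> dom (radial T t)"
proof -
  define y where "y n = the (op_power op n f)" for n
  have "op_power op n f = Some (y n)" for n
  proof -
    have "f \<in> dom (op_power op n)" using f by (simp add: C_infinity_def)
    then show ?thesis by (auto simp: y_def)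
  qed
  then have y: "spectral_integral E (\<lambda>z. z ^ n) f = Some (y n)" for n
    by (rule spectral_integral_power_if_op_power)
  define a where "a n = m 0 * t ^ n / m n" for n
  have a: "a n \<ge> 0" for n using pos t by (simp add: a_def less_imp_le)
  define u where "u z = cnj (sgn z)" for z :: complex
  have [measurable]: "cnj \<in> borel_measurable borel"
    by (intro borel_measurable_continuous_onI continuous_intros)
  have [measurable]: "u \<in> borel_measurable borel"
    unfolding u_def sgn_eq by measurable
  have u_le: "cmod (u z ^ n) \<le> 1" for z n
    by (simp add: u_def norm_power norm_sgn power_le_one)
  have u_mult: "u z ^ n * z ^ n = complex_of_real (cmod z ^ n)" for z n
  proof -
    have "u z * z = complex_of_real (cmod z)"
      by (simp add: u_def sgn_eq complex_norm_square[symmetric] mult.commute power2_eq_square)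
    then show ?thesis by (simp flip: power_mult_distrib)
  qed
  have u: "bounded_borel (\<lambda>z. u z ^ n)" for n
    using u_le by (intro bounded_borelI[of _ 1]) auto
  define v where "v n = a n *\<^sub>R calc (\<lambda>z. u z ^ n) (y n)" for n
  have v_le: "norm (v n) \<le> m 0 * (4 * bound) * c * (t * \<alpha>) ^ n" for n
  proof -
    have "norm (calc (\<lambda>z. u z ^ n) (y n)) \<le> norm (calc (\<lambda>z. u z ^ n)) * norm (y n)"
      by (rule norm_blinfun)
    also have "\<dots> \<le> (4 * bound * 1) * (c * \<alpha> ^ n * m n)"
      using le bound_nonneg by (intro mult_mono norm_calc_le u_le) (auto simp: y_def)
    finally have "norm (v n) \<le> a n * ((4 * bound * 1) * (c * \<alpha> ^ n * m n))"
      unfolding v_def using a[of n] by (auto intro!: mult_left_mono)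
    also have "\<dots> = m 0 * (4 * bound) * c * (t * \<alpha>) ^ n"
      using pos[of n] by (simp add: a_def power_mult_distrib)
    finally show ?thesis .
  qed
  have "summable (\<lambda>n. m 0 * (4 * bound) * c * (t * \<alpha>) ^ n)"
    using t \<alpha> by (intro summable_mult summable_geometric) auto
  then have "summable v"
    by (rule summable_comparison_test'[of _ 0]) (rule v_le)
  then have w: "(\<lambda>N. \<Sum>n<N. v n) \<longlonglongrightarrow> suminf v" by (rule summable_LIMSEQ)
  have "radial T t f = Some (suminf v)"
  proof (rule spectral_integral_SomeI[OF _ ball_exhaustion])
    show meas: "(\<lambda>z. complex_of_real (T (t * cmod z))) \<in> borel_measurable borel"
      using continuous_T t by (intro measurable_radial) auto
    show T_le: "cmod (complex_of_real (T (t * cmod z))) \<le> T (t * real k)"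
      if "z \<in> cball 0 (real k)" for z k
      using that t T_nonneg[of "t * cmod z"] by (auto intro!: T_mono mult_left_mono)
    fix k
    let ?S = "cball 0 (real k) :: complex set"
    define g where "g n z = complex_of_real (a n) * (u z ^ n * (z ^ n * indicator ?S z))" for n z
    have ug: "bounded_borel (\<lambda>z. u z ^ n * (z ^ n * indicator ?S z))" for n
      by (intro bounded_borel_mult u bounded_borel_power_ball)
    have g: "bounded_borel (g n)" for n
      unfolding g_def by (intro bounded_borel_mult[OF bounded_borel_const] ug)
    have g_eq: "g n z = complex_of_real (a n * cmod z ^ n) * indicator ?S z" for n z
      unfolding g_def mult.assoc[symmetric] using u_mult[of z n]
      by (simp add: mult.assoc)
    \<comment> \<open>\<open>E ?S\<close> commutes with the bounded operator u(A)^n, and on the ball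
      \<open>y n\<close> is the integral of z^n.\<close>
    have Ev: "E ?S (v n) = calc (g n) f" for n
    proof -
      have "E ?S (v n) = a n *\<^sub>R E ?S (calc (\<lambda>z. u z ^ n) (y n))"
        by (simp add: v_def blinfun.scaleR_right)
      also have "E ?S (calc (\<lambda>z. u z ^ n) (y n)) = calc (\<lambda>z. u z ^ n) (E ?S (y n))"
        using calc_restrict[OF u, of ?S] by simp
      also have "E ?S (y n) = calc (\<lambda>z. z ^ n * indicator ?S z) f"
        using y[of n] by (simp only: spectral_integral_power_iff)
      also have "a n *\<^sub>R calc (\<lambda>z. u z ^ n) \<dots> = calc (g n) f"
        unfolding g_def using calc_scaleR_mult[OF ug, of "a n" n f] calc_mult[OF u bounded_borel_power_ball, of n n k f]
        by simp
      finally show ?thesis .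
    qed
    have "(\<lambda>N. calc (\<lambda>z. \<Sum>n<N. g n z) f) \<longlonglongrightarrow> calc (\<lambda>z. complex_of_real (T (t * cmod z)) * indicator ?S z) f"
    proof (rule calc_uniform_limit)
      show "bounded_borel (\<lambda>z. \<Sum>n<N. g n z)" for N using calc_sum[of "{..<N}" g] g by simp
      show "bounded_borel (\<lambda>z. complex_of_real (T (t * cmod z)) * indicator ?S z)"
        using T_le by (intro bounded_borel_restrict[OF meas]) auto
      \<comment> \<open>Inside the ball the error is the remainder at t|z|, at most the one at the
        radius; outside, both functions vanish.\<close>
      show "cmod ((\<Sum>n<N. g n z) - complex_of_real (T (t * cmod z)) * indicator ?S z)
          \<le> T (t * k) - m 0 * (\<Sum>n<N. (t * k) ^ n / m n)" for N z
      proof (cases "z \<in> ?S")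
        case True
        define p where "p = m 0 * (\<Sum>n<N. (t * cmod z) ^ n / m n)"
        have "(\<Sum>n<N. g n z) = complex_of_real p"
          using True by (simp add: p_def g_eq a_def power_mult_distrib sum_distrib_left mult.assoc)
        then have "cmod ((\<Sum>n<N. g n z) - complex_of_real (T (t * cmod z)) * indicator ?S z) =
            cmod (complex_of_real (p - T (t * cmod z)))"
          using True by simp
        also have "\<dots> = \<bar>T (t * cmod z) - m 0 * (\<Sum>n<N. (t * cmod z) ^ n / m n)\<bar>"
          unfolding norm_of_real p_def by (rule abs_minus_commute)
        also have "\<dots> \<le> T (t * k) - m 0 * (\<Sum>n<N. (t * k) ^ n / m n)"
          using T_minus_partial_sum_bounds[of "t * cmod z" "t * k" N] True t
          by (simp add: mult_left_mono)
        finally show ?thesis .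
      next
        case False
        then show ?thesis
          using T_minus_partial_sum_bounds(1)[of "t * k" "t * k" N] t by (simp add: g_eq)
      qed
    qed (rule T_partial_sum_tendsto)
    moreover have "calc (\<lambda>z. \<Sum>n<N. g n z) f = E ?S (\<Sum>n<N. v n)" for N
      using calc_sum[of "{..<N}" g f] g by (simp add: blinfun.sum_right Ev)
    moreover have "(\<lambda>N. E ?S (\<Sum>n<N. v n)) \<longlonglongrightarrow> E ?S (suminf v)"
      using w by (intro tendsto_intros)
    ultimately show "E ?S (suminf v) = calc (\<lambda>z. complex_of_real (T (t * cmod z)) * indicator ?S z) f"
      using LIMSEQ_unique by auto
  qed
  then show ?thesis by auto
qed

lemma Carleman_Roumieu_eq: "Carleman_Roumieu op m = (\<Union>t\<in>{0<..}. dom (radial T t))"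
proof (intro equalityI subsetI)
  fix f assume "f \<in> Carleman_Roumieu op m"
  then obtain \<alpha> c where "f \<in> C_infinity op" "\<alpha> > 0"
    "\<And>n. norm (the (op_power op n f)) \<le> c * \<alpha> ^ n * m n"
    by (auto simp: Carleman_Roumieu_def)
  \<comment> \<open>Halving makes t\<alpha> = 1/2, strictly below 1; the converse inclusion yields
    \<alpha> = 1/t with no loss.\<close>
  then have "f \<in> dom (radial T (1 / (2 * \<alpha>)))"
    by (intro growth_imp_dom_radial_T) auto
  then show "f \<in> (\<Union>t\<in>{0<..}. dom (radial T t))"
    using \<open>\<alpha> > 0\<close> by (intro UN_I[of "1 / (2 * \<alpha>)"]) auto
next
  fix f assume "f \<in> (\<Union>t\<in>{0<..}. dom (radial T t))"
  then obtain t where t: "t > 0" "f \<in> dom (radial T t)" by blast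
  have "1 / t > 0" using t by simp
  then show "f \<in> Carleman_Roumieu op m"
    using dom_radial_T_imp_growth[OF t(2,1)] unfolding Carleman_Roumieu_def by blast
qed

lemma Carleman_Beurling_eq: "Carleman_Beurling op m = (\<Inter>t\<in>{0<..}. dom (radial T t))"
proof (intro equalityI subsetI INT_I)
  fix f and t :: real assume f: "f \<in> Carleman_Beurling op m" and "t \<in> {0<..}"
  then have t: "t > 0" by simp
  moreover from this have "1 / (2 * t) > 0" by simp
  with f obtain c where "f \<in> C_infinity op"
    "\<And>n. norm (the (op_power op n f)) \<le> c * (1 / (2 * t)) ^ n * m n"
    unfolding Carleman_Beurling_def by blast
  ultimately show "f \<in> dom (radial T t)"
    by (intro growth_imp_dom_radial_T[where \<alpha> = "1 / (2 * t)"]) auto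
next
  fix f assume f: "f \<in> (\<Inter>t\<in>{0<..}. dom (radial T t))"
  have *: "f \<in> C_infinity op \<and> (\<exists>c>0. \<forall>n. norm (the (op_power op n f)) \<le> c * \<alpha> ^ n * m n)"
    if "\<alpha> > 0" for \<alpha>
  proof -
    have "f \<in> dom (radial T (1 / \<alpha>))" by (rule INT_D[OF f]) (use that in simp)
    from dom_radial_T_imp_growth[OF this] that show ?thesis by simp
  qed
  \<comment> \<open>Membership in \<open>C_infinity\<close> is taken from the instance \<alpha> =
    1.\<close>
  show "f \<in> Carleman_Beurling op m"
    unfolding Carleman_Beurling_def
    using *[OF zero_less_one, THEN conjunct1] *[THEN conjunct2] by (intro CollectI conjI allI impI)
qed

section \<open>Replacing T by a comparable function\<close>

text \<open>Below the threshold \<open>R\<close> no comparison with \<open>G\<close> is given, but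
  monotonicity bounds \<open>F\<close> there by \<open>F (\<gamma> * R)\<close>. The constant
  \<open>D\<close> covers both ranges.\<close>

lemma dom_radial_mono:
  fixes F G :: "real \<Rightarrow> real"
  assumes F: "continuous_on {0..} F" "mono_on {0..} F" "\<And>x. 0 \<le> x \<Longrightarrow> 0 \<le> F x"
    and G: "continuous_on {0..} G" "\<And>x. 0 \<le> x \<Longrightarrow> 0 \<le> G x"
    and \<gamma>: "\<gamma> > 0" and R: "\<And>x. x \<ge> R \<Longrightarrow> F (\<gamma> * x) \<le> C * G x" "R \<ge> 0" and t: "t > 0"
  shows "dom (radial G t) \<subseteq> dom (radial F (\<gamma> * t))"
proof (rule dom_spectral_integral_mono)
  define D where "D = max (F (\<gamma> * R)) (max C 0)"
  fix z :: complex
  have "0 \<le> D" by (simp add: D_def)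
  define x where "x = t * cmod z"
  have x: "0 \<le> x" using t by (simp add: x_def)
  have "F (\<gamma> * x) \<le> D * (1 + G x)"
  proof (cases "x \<ge> R")
    case True
    have "F (\<gamma> * x) \<le> C * G x" using R True by simp
    also have "\<dots> \<le> D * (1 + G x)"
      using G(2)[OF x] by (intro mult_mono) (auto simp: D_def)
    finally show ?thesis .
  next
    case False
    then have "F (\<gamma> * x) \<le> F (\<gamma> * R)"
      using x \<gamma> \<open>R \<ge> 0\<close> by (intro mono_onD[OF F(2)]) auto
    also have "\<dots> \<le> D * 1" by (simp add: D_def)
    also have "\<dots> \<le> D * (1 + G x)" using G(2)[OF x] \<open>0 \<le> D\<close> by (intro mult_left_mono) auto
    finally show ?thesis .
  qed
  then show "cmod (complex_of_real (F (\<gamma> * t * cmod z))) \<le> D * (1 + cmod (complex_of_real (G (t * cmod z))))"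
    using F(3)[of "\<gamma> * x"] G(2)[OF x] x \<gamma> by (simp add: x_def mult.assoc)
qed (use \<gamma> t in \<open>simp_all add: measurable_radial F(1) G(1)\<close>)

text \<open>Domains at one and the same t need not agree, but multiplication by a positive number
  permutes the parameters t > 0, so unions and intersections do agree.\<close>

lemma dom_radial_equivalent:
  assumes F: "\<And>x. 0 \<le> x \<Longrightarrow> 0 \<le> F x" "continuous_on {0..} F" "mono_on {0..} F"
    and pos: "\<gamma>\<^sub>1 > 0" "\<gamma>\<^sub>2 > 0" "c\<^sub>1 > 0" "c\<^sub>2 > 0" "R \<ge> 0"
    and le: "\<And>x. x \<ge> R \<Longrightarrow> c\<^sub>1 * F (\<gamma>\<^sub>1 * x) \<le> T x \<and> T x \<le> c\<^sub>2 * F (\<gamma>\<^sub>2 * x)"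
  shows "(\<Union>t\<in>{0<..}. dom (radial T t)) = (\<Union>t\<in>{0<..}. dom (radial F t))"
    and "(\<Inter>t\<in>{0<..}. dom (radial T t)) = (\<Inter>t\<in>{0<..}. dom (radial F t))"
proof -
  have T: "continuous_on {0..} T" "mono_on {0..} T" "\<And>x. 0 \<le> x \<Longrightarrow> 0 \<le> T x"
    by (auto simp: continuous_T T_nonneg intro: mono_onI T_mono)
  have TF: "dom (radial T t) \<subseteq> dom (radial F (\<gamma>\<^sub>1 * t))" if "t > 0" for t
  proof (rule dom_radial_mono[OF F(2,3,1) T(1,3) pos(1) _ pos(5) that])
    fix x assume "x \<ge> R"
    then show "F (\<gamma>\<^sub>1 * x) \<le> (1 / c\<^sub>1) * T x" using le[of x] pos by (simp add: field_simps)
  qed auto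
  have FT: "dom (radial F t) \<subseteq> dom (radial T ((1 / \<gamma>\<^sub>2) * t))" if "t > 0" for t
  proof (rule dom_radial_mono[OF T F(2,1)])
    \<comment> \<open>The hypothesis is applied at \<open>x / \<gamma>\<^sub>2\<close>, which scales
      the threshold.\<close>
    fix x assume "x \<ge> \<gamma>\<^sub>2 * R"
    then have "x / \<gamma>\<^sub>2 \<ge> R" using pos by (simp add: field_simps)
    from le[OF this] show "T (1 / \<gamma>\<^sub>2 * x) \<le> c\<^sub>2 * F x" using pos by simp
  qed (use pos that in auto)
  show "(\<Union>t\<in>{0<..}. dom (radial T t)) = (\<Union>t\<in>{0<..}. dom (radial F t))"
  proof (intro equalityI UN_least)
    fix t :: real assume "t \<in> {0<..}"
    then have t: "t > 0" by simp
    show "dom (radial T t) \<subseteq> (\<Union>t\<in>{0<..}. dom (radial F t))"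
    proof (rule order.trans[OF TF[OF t]])
      show "dom (radial F (\<gamma>\<^sub>1 * t)) \<subseteq> (\<Union>t\<in>{0<..}. dom (radial F t))"
        using pos t by (intro UN_upper) simp
    qed
    show "dom (radial F t) \<subseteq> (\<Union>t\<in>{0<..}. dom (radial T t))"
    proof (rule order.trans[OF FT[OF t]])
      show "dom (radial T ((1 / \<gamma>\<^sub>2) * t)) \<subseteq> (\<Union>t\<in>{0<..}. dom (radial T t))"
        using pos t by (intro UN_upper) simp
    qed
  qed
  show "(\<Inter>t\<in>{0<..}. dom (radial T t)) = (\<Inter>t\<in>{0<..}. dom (radial F t))"
  proof (intro equalityI INT_greatest)
    fix t :: real assume "t \<in> {0<..}"
    then have t: "t > 0" by simp
    have "t / \<gamma>\<^sub>1 > 0" using t pos by simp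
    then have "(\<Inter>t\<in>{0<..}. dom (radial T t)) \<subseteq> dom (radial T (t / \<gamma>\<^sub>1))"
      by (intro INT_lower) simp
    also have "\<dots> \<subseteq> dom (radial F t)"
      using TF[OF \<open>t / \<gamma>\<^sub>1 > 0\<close>] pos by simp
    finally show "(\<Inter>t\<in>{0<..}. dom (radial T t)) \<subseteq> dom (radial F t)" .
    have "\<gamma>\<^sub>2 * t > 0" using t pos by simp
    then have "(\<Inter>t\<in>{0<..}. dom (radial F t)) \<subseteq> dom (radial F (\<gamma>\<^sub>2 * t))"
      by (intro INT_lower) simp
    also have "\<dots> \<subseteq> dom (radial T t)"
      using FT[OF \<open>\<gamma>\<^sub>2 * t > 0\<close>] pos by simp
    finally show "(\<Inter>t\<in>{0<..}. dom (radial F t)) \<subseteq> dom (radial T t)" .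
  qed
qed

end

theorem theorem3p1:
  fixes m :: "nat \<Rightarrow> real"
    and A :: "'a::complex_banach \<rightharpoonup> 'a"
  assumes m_pos: "\<And>n. m n > 0"
    and m_growth: "\<And>\<alpha>. \<alpha> > 0 \<Longrightarrow> \<exists>c>0. \<forall>n. c * \<alpha> ^ n \<le> m n"
    and A: "scalar_type_spectral A"
  shows "Carleman_Roumieu A m = (\<Union>t\<in>{0<..}. dom (abs_calculus A (T_function m) t)) \<and>
    Carleman_Beurling A m = (\<Inter>t\<in>{0<..}. dom (abs_calculus A (T_function m) t)) \<and>
    (\<forall>F :: real \<Rightarrow> real.
       (\<forall>x\<ge>0. F x \<ge> 0) \<longrightarrow> continuous_on {0..} F \<longrightarrow> mono_on {0..} F \<longrightarrow>
       (\<exists>\<gamma>\<^sub>1>0. \<exists>\<gamma>\<^sub>2>0. \<exists>c\<^sub>1>0. \<exists>c\<^sub>2>0. \<exists>R\<ge>0. \<forall>x\<ge>R.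
          c\<^sub>1 * F (\<gamma>\<^sub>1 * x) \<le> T_function m x \<and> T_function m x \<le> c\<^sub>2 * F (\<gamma>\<^sub>2 * x)) \<longrightarrow>
       Carleman_Roumieu A m = (\<Union>t\<in>{0<..}. dom (abs_calculus A F t)) \<and>
       Carleman_Beurling A m = (\<Inter>t\<in>{0<..}. dom (abs_calculus A F t)))"
proof -
  \<comment> \<open>This is the very choice made in \<open>op_calculus\<close>, so
    \<open>abs_calculus\<close> unfolds to \<open>radial\<close> for this \<open>E\<close>.\<close>
  define E where "E = resolution_of_identity A"
  have "\<exists>E. is_resolution_of_identity A E" using A by (simp add: scalar_type_spectral_def)
  then have "is_resolution_of_identity A E"
    unfolding E_def resolution_of_identity_def by (rule someI_ex)
  then have E: "spectral_measure E" "A = spectral_integral E (\<lambda>z. z)"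
    by (auto simp: is_resolution_of_identity_def)
  interpret spectral_growth E m
    by (intro spectral_growth.intro spectral.intro growth_sequence.intro E(1) m_pos m_growth)
  have abs: "abs_calculus A F t = radial F t" for F t
    by (simp add: abs_calculus_def op_calculus_def E_def)
  have equivalent: "Carleman_Roumieu A m = (\<Union>t\<in>{0<..}. dom (radial F t)) \<and>
      Carleman_Beurling A m = (\<Inter>t\<in>{0<..}. dom (radial F t))"
    if "\<forall>x\<ge>0. F x \<ge> 0" "continuous_on {0..} F" "mono_on {0..} F"
      "\<exists>\<gamma>\<^sub>1>0. \<exists>\<gamma>\<^sub>2>0. \<exists>c\<^sub>1>0. \<exists>c\<^sub>2>0. \<exists>R\<ge>0. \<forall>x\<ge>R.
        c\<^sub>1 * F (\<gamma>\<^sub>1 * x) \<le> T_function m x \<and> T_function m x \<le> c\<^sub>2 * F (\<gamma>\<^sub>2 * x)" for F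
  proof -
    from that(4) obtain \<gamma>\<^sub>1 \<gamma>\<^sub>2 c\<^sub>1 c\<^sub>2 R where *: "\<gamma>\<^sub>1 > 0" "\<gamma>\<^sub>2 > 0" "c\<^sub>1 > 0" "c\<^sub>2 > 0" "R \<ge> 0"
      "\<forall>x\<ge>R. c\<^sub>1 * F (\<gamma>\<^sub>1 * x) \<le> T x \<and> T x \<le> c\<^sub>2 * F (\<gamma>\<^sub>2 * x)"
      by blast
    show ?thesis
      using Carleman_Roumieu_eq Carleman_Beurling_eq
        dom_radial_equivalent[OF that(1)[rule_format] that(2,3) *(1-5) *(6)[rule_format]]
      by (simp add: E(2))
  qed
  have T: "Carleman_Roumieu A m = (\<Union>t\<in>{0<..}. dom (radial T t))"
    "Carleman_Beurling A m = (\<Inter>t\<in>{0<..}. dom (radial T t))"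
    using Carleman_Roumieu_eq Carleman_Beurling_eq by (simp_all add: E(2))
  show ?thesis
    unfolding abs
    by (rule conjI[OF T(1) conjI[OF T(2)]]) (intro allI impI, rule equivalent)
qed

end
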